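(* Let $\mu,\nu\in\mathcal N_G$ with $\nu\le\mu$. Then $\mathbb A(F)_{\le\nu}$ is contained in $\mathbb A(F)_{\le\mu}$ with $k$-codimension $$\sum_{i=1}^l[\langle\omega_i,\mu\rangle]-\sum_{i=1}^l[\langle\omega_i,\nu\rangle],$$ a non-negative integer independent of the choice of the extensions $\omega_i$ of the fundamental weights $\varpi_i$. Here $[a]$ denotes the greatest integer in the real number $a$.
   Context: Field: $\mathcal O$ is a complete discrete valuation ring with uniformizer $\pi$ and algebraically closed residue field $k=\mathcal O/\pi\mathcal O$; $F$ is its fraction field. The convention is the negative of the usual valuation: $\mathrm{val}:F^\times\to\mathbb Z$ is normalized by $\mathrm{val}(\pi)=-1$, with $\mathrm{val}(0)=-\infty$. Group: $G$ is a split connected reductive group over $\mathcal O$ with simply connected derived group $G_{\mathrm{sc}}$; $A\subset B$ are a split maximal torus and a Borel subgroup (over $\mathcal O$); $W$ is the Weyl group of $A$ in $G$; $D=G/G_{\mathrm{sc}}$ (a split torus), $A_{\mathrm{sc}}=A\cap G_{\mathrm{sc}}$, so that $0\to X^*(D)\to X^*(A)\to X^*(A_{\mathrm{sc}})\to 0$ is exact. $\alpha_1,\dots,\alpha_l$ are the simple roots, with set $\Delta$; $\alpha_1^\vee,\dots,\alpha_l^\vee$ the simple coroots (a $\mathbb Z$-basis of $X_*(A_{\mathrm{sc}})$), $\varpi_1,\dots,\varpi_l\in X^*(A_{\mathrm{sc}})$ the dual basis (fundamental weights). For $1\le i\le l$, $\omega_i\in X^*(A)$ is a chosen extension of $\varpi_i$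 to $A$, and $\omega_{l+1},\dots,\omega_n$ is a chosen basis of $X^*(D)$, where $n=\dim A$. $\mathfrak a=X_*(A)\otimes\mathbb R$, with a fixed $W$-invariant Euclidean inner product. $\mathfrak a_{\mathrm{dom}}=\{x\in\mathfrak a:\langle\alpha_i,x\rangle\ge0,\ 1\le i\le l\}$. For $x,y\in\mathfrak a$, $x\le y$ means that $y-x$ is a non-negative linear combination of simple coroots. The set $\mathcal N_G$: a standard parabolic $P=MN$ is a parabolic subgroup containing $B$, with unipotent radical $N$ and $M$ the Levi subgroup containing $A$; $\Delta=\Delta_M\sqcup\Delta_N$ with $\Delta_M$ the simple roots of $M$ and $\Delta_N$ the simple roots of $G$ occurring in $\mathrm{Lie}(N)$. $\mathfrak a_M=\{x\in\mathfrak a:\langle\alpha,x\rangle=0\ \forall\alpha\in\Delta_M\}$; $p_M:\mathfrak a\to\mathfrak a_M$ is the projection along the span of the simple coroots of $M$; $\Lambda_M$ is the quotient of $X_*(A)$ by the coroot lattice of $M$, identified with the lattice $p_M(X_*(A))\subset\mathfrak a_M$; $\mathfrak a_P^+=\{x\in\mathfrak a_M:\langle\alpha,x\rangle>0\ \forall\alpha\in\Delta_N\}$; $\Lambda_P^+=\Lambda_M\cap\mathfrak a_P^+$. Then $\mathcal N_G=\coprod_P\Lambda_P^+\subset\mathfrak a_{\mathrm{dom}}$, over all standard parabolic subgroups $P$. Map $r$: for $x\in\mathfrak a$, $r(x)$ is the unique point of $\mathfrak a_{\mathrm{dom}}$ closest to $x$. Identify $\mathfrak a$ with $\mathbb R^n$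 by $x\mapsto(\langle\omega_1,x\rangle,\dots,\langle\omega_n,x\rangle)$. Let $\tilde{\mathbb R}=\mathbb R\cup\{-\infty\}$, with the intervals $[-\infty,a)$ as neighborhood base at $-\infty$; $r$ extends (uniquely) to a continuous map, still called $r$, $\tilde{\mathbb R}^l\times\mathbb R^{n-l}\to\mathfrak a_{\mathrm{dom}}$. Adjoint quotient: $\mathbb A=A/W$ is identified with $\mathbb A^l\times\mathbb G_m^{n-l}$ by the functions $c_i=\sum_{\lambda\in W\omega_i}e^\lambda$ ($1\le i\le n$; $e^\lambda$ is $\lambda$ viewed as a regular function on $A$), so $\mathbb A(F)=F^l\times(F^\times)^{n-l}$. For $c=(c_1,\dots,c_n)\in\mathbb A(F)$ put $d_c=(\mathrm{val}\,c_1,\dots,\mathrm{val}\,c_n)$. For $\mu\in\mathcal N_G$, $\mathbb A(F)_{\le\mu}=\{c\in\mathbb A(F):r(d_c)\le\mu\}$. Dimensions: put $P^j=\pi^j\mathcal O$. For integers $j_1,\dots,j_l$ and a coset $C$ of $(\mathcal O^\times)^{n-l}$ in $(F^\times)^{n-l}$, the subset $P^{j_1}\times\dots\times P^{j_l}\times C$ of $\mathbb A(F)$ is assigned the ($k$-)dimension $-(j_1+\dots+j_l)$. Each $\mathbb A(F)_{\le\mu}$ is a subset of this form, and the $k$-codimension of one such subset in another one containing it (with the same $C$) is the difference of their dimensions. *)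

theory Defs
  imports
    "HOL-Analysis.Analysis"
    "HOL-Algebra.Algebraic_Closure"
    "HOL-Library.Poly_Mapping"
begin

section \<open>The discrete valuation ring\<close>

text \<open>The field \<open>F\<close> is a type of class \<open>field\<close> and \<open>\<O>\<close> is a subset of it, viewed as a ring in the
  sense of HOL-Algebra with the operations inherited from \<open>F\<close>.\<close>

definition ring_on :: "'r::ring_1 set \<Rightarrow> 'r ring" where
  "ring_on R = \<lparr>carrier = R, monoid.mult = (*), one = 1, zero = 0, add = (+)\<rparr>"

definition dvr :: "'f::field set \<Rightarrow> 'f \<Rightarrow> bool" where
  "dvr \<O> \<pi> \<longleftrightarrow>
     principal_domain (ring_on \<O>) \<and>
     \<pi> \<in> \<O> \<and> \<pi> \<noteq> 0 \<and>
     (\<forall>I. primeideal I (ring_on \<O>) \<and> I \<noteq> {0} \<longleftrightarrow> I = PIdl\<^bsub>ring_on \<O>\<^esub> \<pi>)"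

definition fraction_field_of :: "'f::field set \<Rightarrow> bool" where
  "fraction_field_of \<O> \<longleftrightarrow> (\<forall>x. \<exists>a\<in>\<O>. \<exists>b\<in>\<O>. b \<noteq> 0 \<and> x = a / b)"

definition frac_ideal :: "'f::field set \<Rightarrow> 'f \<Rightarrow> int \<Rightarrow> 'f set" where
  "frac_ideal \<O> \<pi> j = {\<pi> powi j * a | a. a \<in> \<O>}"

definition adically_complete :: "'f::field set \<Rightarrow> 'f \<Rightarrow> bool" where
  "adically_complete \<O> \<pi> \<longleftrightarrow>
     (\<forall>s::nat \<Rightarrow> 'f. (\<forall>m. s m \<in> \<O>) \<and> (\<forall>m. s (Suc m) - s m \<in> frac_ideal \<O> \<pi> (int m)) \<longrightarrow>
        (\<exists>x\<in>\<O>. \<forall>m. s m - x \<in> frac_ideal \<O> \<pi> (int m)))"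

definition residue_ring_on :: "'f::field set \<Rightarrow> 'f \<Rightarrow> 'f set ring" where
  "residue_ring_on \<O> \<pi> = ring_on \<O> Quot (PIdl\<^bsub>ring_on \<O>\<^esub> \<pi>)"

definition units_on :: "'f::field set \<Rightarrow> 'f set" where
  "units_on \<O> = Units (ring_on \<O>)"

text \<open>The sign is the negative of the usual one: \<open>\<pi>\<close> has valuation \<open>-1\<close>.\<close>

definition val :: "'f::field set \<Rightarrow> 'f \<Rightarrow> 'f \<Rightarrow> ereal" where
  "val \<O> \<pi> x =
     (if x = 0 then -\<infinity>
      else ereal (real_of_int (- (THE m::int. \<exists>u\<in>units_on \<O>. x = u * \<pi> powi m))))"


section \<open>Root data\<close>

text \<open>The real vector space \<open>\<aa> = X\<^sub>*(A) \<otimes> \<real>\<close> is a type of class \<open>{real_inner, heine_borel}\<close>, that is,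
  a finite-dimensional real inner product space (possibly of dimension 0, which
  \<open>euclidean_space\<close> would exclude).  The lattice \<open>X\<^sub>*(A)\<close> is a subset \<open>L\<close> of it, and \<open>X\<^sup>*(A)\<close>
  is the dual lattice inside the dual space; the pairing is application.\<close>

type_synonym 'a dual = "'a \<Rightarrow>\<^sub>L real"

global_interpretation int_mod:
  Modules.module "\<lambda>(k::int) (x::'v::real_vector). real_of_int k *\<^sub>R x"
  by unfold_locales (simp_all add: scaleR_add_right scaleR_add_left)

definition char_lattice :: "'a::{real_inner,heine_borel} set \<Rightarrow> 'a dual set" where
  "char_lattice L = {\<xi>. \<forall>x\<in>L. blinfun_apply \<xi> x \<in> \<int>}"

definition root_refl ::
  "('a::{real_inner,heine_borel} dual \<Rightarrow> 'a) \<Rightarrow> 'a dual \<Rightarrow> 'a dual \<Rightarrow> 'a dual" where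
  "root_refl cor \<beta> \<xi> = \<xi> - blinfun_apply \<xi> (cor \<beta>) *\<^sub>R \<beta>"

definition coroot_refl ::
  "('a::{real_inner,heine_borel} dual \<Rightarrow> 'a) \<Rightarrow> 'a dual \<Rightarrow> 'a \<Rightarrow> 'a" where
  "coroot_refl cor \<beta> x = x - blinfun_apply \<beta> x *\<^sub>R cor \<beta>"

text \<open>A split connected reductive group over \<open>\<O>\<close> with its split maximal torus \<open>A\<close> is given by its
  (reduced) root datum; \<open>\<Phi>\<close> is the set of roots, and \<open>cor \<beta>\<close> is the coroot of \<open>\<beta>\<close>.\<close>

locale root_datum =
  fixes L :: "'a::{real_inner,heine_borel} set"
    and \<Phi> :: "'a dual set"
    and cor :: "'a dual \<Rightarrow> 'a"
  assumes lattice: "\<exists>B. finite B \<and> independent B \<and> span B = UNIV \<and> L = int_mod.span B"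
    and finite_roots: "finite \<Phi>"
    and roots_in_lattice: "\<Phi> \<subseteq> char_lattice L"
    and coroots_in_lattice: "cor ` \<Phi> \<subseteq> L"
    and inj_coroot: "inj_on cor \<Phi>"
    and root_coroot: "\<beta> \<in> \<Phi> \<Longrightarrow> blinfun_apply \<beta> (cor \<beta>) = 2"
    and refl_root: "\<beta> \<in> \<Phi> \<Longrightarrow> \<gamma> \<in> \<Phi> \<Longrightarrow> root_refl cor \<beta> \<gamma> \<in> \<Phi>"
    and corefl_coroot: "\<beta> \<in> \<Phi> \<Longrightarrow> \<gamma> \<in> \<Phi> \<Longrightarrow> coroot_refl cor \<beta> (cor \<gamma>) \<in> cor ` \<Phi>"
    and reduced: "\<beta> \<in> \<Phi> \<Longrightarrow> t *\<^sub>R \<beta> \<in> \<Phi> \<Longrightarrow> t = 1 \<or> t = -1"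

text \<open>The derived group is simply connected iff \<open>X\<^sub>*(A\<^sub>s\<^sub>c)\<close>, the intersection of \<open>X\<^sub>*(A)\<close> with the
  span of the coroots, is the coroot lattice.\<close>

definition simply_connected_derived ::
  "'a::{real_inner,heine_borel} set \<Rightarrow> 'a dual set \<Rightarrow> ('a dual \<Rightarrow> 'a) \<Rightarrow> bool" where
  "simply_connected_derived L \<Phi> cor \<longleftrightarrow> L \<inter> span (cor ` \<Phi>) = int_mod.span (cor ` \<Phi>)"

text \<open>Invariance of the inner product under the Weyl group, which is generated by the reflections.\<close>

definition weyl_invariant_inner ::
  "'a::{real_inner,heine_borel} dual set \<Rightarrow> ('a dual \<Rightarrow> 'a) \<Rightarrow> bool" where
  "weyl_invariant_inner \<Phi> cor \<longleftrightarrow>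
     (\<forall>\<beta>\<in>\<Phi>. \<forall>x y. coroot_refl cor \<beta> x \<bullet> coroot_refl cor \<beta> y = x \<bullet> y)"

text \<open>The choice of the Borel subgroup \<open>B\<close> containing \<open>A\<close>: a base \<open>\<alpha> 1, \<dots>, \<alpha> l\<close> of \<open>\<Phi>\<close>.\<close>

definition simple_roots ::
  "'a::{real_inner,heine_borel} dual set \<Rightarrow> nat \<Rightarrow> (nat \<Rightarrow> 'a dual) \<Rightarrow> bool" where
  "simple_roots \<Phi> l \<alpha> \<longleftrightarrow>
     inj_on \<alpha> {1..l} \<and> \<alpha> ` {1..l} \<subseteq> \<Phi> \<and> independent (\<alpha> ` {1..l}) \<and>
     (\<forall>\<beta>\<in>\<Phi>. \<exists>k::nat \<Rightarrow> nat. \<beta> = (\<Sum>i=1..l. real (k i) *\<^sub>R \<alpha> i) \<or>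
                             \<beta> = - (\<Sum>i=1..l. real (k i) *\<^sub>R \<alpha> i))"

text \<open>The restriction of \<open>\<omega> i\<close> to \<open>A\<^sub>s\<^sub>c\<close> is the fundamental weight dual to the \<open>i\<close>-th simple coroot.\<close>

definition extend_fundamental_weights ::
  "'a::{real_inner,heine_borel} set \<Rightarrow> ('a dual \<Rightarrow> 'a) \<Rightarrow> nat \<Rightarrow> (nat \<Rightarrow> 'a dual) \<Rightarrow>
   (nat \<Rightarrow> 'a dual) \<Rightarrow> bool" where
  "extend_fundamental_weights L cor l \<alpha> \<omega> \<longleftrightarrow>
     (\<forall>i\<in>{1..l}. \<omega> i \<in> char_lattice L \<and>
        (\<forall>j\<in>{1..l}. blinfun_apply (\<omega> i) (cor (\<alpha> j)) = (if i = j then 1 else 0)))"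

text \<open>\<open>X\<^sup>*(D)\<close>: the characters of \<open>A\<close> that are trivial on \<open>A\<^sub>s\<^sub>c\<close>.\<close>

definition central_chars ::
  "'a::{real_inner,heine_borel} set \<Rightarrow> ('a dual \<Rightarrow> 'a) \<Rightarrow> nat \<Rightarrow> (nat \<Rightarrow> 'a dual) \<Rightarrow> 'a dual set" where
  "central_chars L cor l \<alpha> =
     {\<xi> \<in> char_lattice L. \<forall>j\<in>{1..l}. blinfun_apply \<xi> (cor (\<alpha> j)) = 0}"

definition basis_central_chars ::
  "'a::{real_inner,heine_borel} set \<Rightarrow> ('a dual \<Rightarrow> 'a) \<Rightarrow> nat \<Rightarrow> (nat \<Rightarrow> 'a dual) \<Rightarrow>
   nat \<Rightarrow> (nat \<Rightarrow> 'a dual) \<Rightarrow> bool" where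
  "basis_central_chars L cor l \<alpha> n \<omega> \<longleftrightarrow>
     inj_on \<omega> {l+1..n} \<and> int_mod.independent (\<omega> ` {l+1..n}) \<and>
     int_mod.span (\<omega> ` {l+1..n}) = central_chars L cor l \<alpha>"


section \<open>The order, the set \<open>\<N>\<^sub>G\<close> and the retraction onto the dominant cone\<close>

definition dom_cone :: "nat \<Rightarrow> (nat \<Rightarrow> 'a::{real_inner,heine_borel} dual) \<Rightarrow> 'a set" where
  "dom_cone l \<alpha> = {x. \<forall>i\<in>{1..l}. 0 \<le> blinfun_apply (\<alpha> i) x}"

definition coroot_le ::
  "('a::{real_inner,heine_borel} dual \<Rightarrow> 'a) \<Rightarrow> nat \<Rightarrow> (nat \<Rightarrow> 'a dual) \<Rightarrow> 'a \<Rightarrow> 'a \<Rightarrow> bool" where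
  "coroot_le cor l \<alpha> x y \<longleftrightarrow>
     (\<exists>t::nat \<Rightarrow> real. (\<forall>i\<in>{1..l}. 0 \<le> t i) \<and> y - x = (\<Sum>i=1..l. t i *\<^sub>R cor (\<alpha> i)))"

text \<open>Standard parabolic subgroups \<open>P = MN\<close> correspond to subsets \<open>J\<close> of \<open>{1..l}\<close>: the simple roots
  of \<open>M\<close> are the \<open>\<alpha> j\<close> with \<open>j \<in> J\<close>, and those of \<open>N\<close> are the others.\<close>

definition levi_space :: "(nat \<Rightarrow> 'a::{real_inner,heine_borel} dual) \<Rightarrow> nat set \<Rightarrow> 'a set" where
  "levi_space \<alpha> J = {x. \<forall>j\<in>J. blinfun_apply (\<alpha> j) x = 0}"

definition levi_proj ::
  "('a::{real_inner,heine_borel} dual \<Rightarrow> 'a) \<Rightarrow> (nat \<Rightarrow> 'a dual) \<Rightarrow> nat set \<Rightarrow> 'a \<Rightarrow> 'a" where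
  "levi_proj cor \<alpha> J x =
     (THE y. y \<in> levi_space \<alpha> J \<and> x - y \<in> span ((\<lambda>j. cor (\<alpha> j)) ` J))"

definition levi_lattice ::
  "'a::{real_inner,heine_borel} set \<Rightarrow> ('a dual \<Rightarrow> 'a) \<Rightarrow> (nat \<Rightarrow> 'a dual) \<Rightarrow> nat set \<Rightarrow> 'a set" where
  "levi_lattice L cor \<alpha> J = levi_proj cor \<alpha> J ` L"

definition open_face ::
  "nat \<Rightarrow> (nat \<Rightarrow> 'a::{real_inner,heine_borel} dual) \<Rightarrow> nat set \<Rightarrow> 'a set" where
  "open_face l \<alpha> J = {x \<in> levi_space \<alpha> J. \<forall>i\<in>{1..l} - J. 0 < blinfun_apply (\<alpha> i) x}"

definition newton_points ::
  "'a::{real_inner,heine_borel} set \<Rightarrow> ('a dual \<Rightarrow> 'a) \<Rightarrow> nat \<Rightarrow> (nat \<Rightarrow> 'a dual) \<Rightarrow> 'a set" where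
  "newton_points L cor l \<alpha> = (\<Union>J\<in>Pow {1..l}. levi_lattice L cor \<alpha> J \<inter> open_face l \<alpha> J)"

text \<open>\<open>n\<close>-tuples are functions in \<open>\<Pi>\<^sub>E i\<in>{1..n}\<close>, with the product topology; \<open>-\<infinity>\<close> is
  allowed in the first \<open>l\<close> coordinates only.\<close>

definition ext_space :: "nat \<Rightarrow> nat \<Rightarrow> (nat \<Rightarrow> ereal) set" where
  "ext_space l n = (\<Pi>\<^sub>E i\<in>{1..n}. if i \<le> l then {..<\<infinity>} else {-\<infinity><..<\<infinity>})"

definition weight_coords ::
  "nat \<Rightarrow> (nat \<Rightarrow> 'a::{real_inner,heine_borel} dual) \<Rightarrow> 'a \<Rightarrow> nat \<Rightarrow> ereal" where
  "weight_coords n \<omega> x = (\<lambda>i\<in>{1..n}. ereal (blinfun_apply (\<omega> i) x))"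

definition retr :: "nat \<Rightarrow> (nat \<Rightarrow> 'a::{real_inner,heine_borel} dual) \<Rightarrow> 'a \<Rightarrow> 'a" where
  "retr l \<alpha> x = closest_point (dom_cone l \<alpha>) x"

definition retr_ext ::
  "nat \<Rightarrow> (nat \<Rightarrow> 'a::{real_inner,heine_borel} dual) \<Rightarrow> nat \<Rightarrow> (nat \<Rightarrow> 'a dual) \<Rightarrow>
   (nat \<Rightarrow> ereal) \<Rightarrow> 'a" where
  "retr_ext l \<alpha> n \<omega> =
     (THE r. r \<in> ext_space l n \<rightarrow>\<^sub>E dom_cone l \<alpha> \<and> continuous_on (ext_space l n) r \<and>
             (\<forall>x. r (weight_coords n \<omega> x) = retr l \<alpha> x))"


section \<open>The adjoint quotient\<close>

inductive_set weyl ::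
  "'a::{real_inner,heine_borel} dual set \<Rightarrow> ('a dual \<Rightarrow> 'a) \<Rightarrow> ('a dual \<Rightarrow> 'a dual) set"
  for \<Phi> cor where
  weyl_id: "id \<in> weyl \<Phi> cor"
| weyl_refl: "w \<in> weyl \<Phi> cor \<Longrightarrow> \<beta> \<in> \<Phi> \<Longrightarrow> root_refl cor \<beta> \<circ> w \<in> weyl \<Phi> cor"

text \<open>The group ring of \<open>X\<^sup>*(A)\<close> with coefficients in \<open>\<O>\<close> is the ring of regular functions on \<open>A\<close>;
  \<open>Poly_Mapping.single \<xi> 1\<close> is the function \<open>e\<^sup>\<xi>\<close>.  Its \<open>W\<close>-invariants are the regular functions
  on \<open>A/W\<close>.\<close>

definition torus_functions ::
  "'f::field set \<Rightarrow> 'a::{real_inner,heine_borel} set \<Rightarrow> ('a dual \<Rightarrow>\<^sub>0 'f) set" where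
  "torus_functions \<O> L =
     {p. Poly_Mapping.keys p \<subseteq> char_lattice L \<and> (\<forall>\<xi>. Poly_Mapping.lookup p \<xi> \<in> \<O>)}"

definition invariant_functions ::
  "'f::field set \<Rightarrow> 'a::{real_inner,heine_borel} set \<Rightarrow> 'a dual set \<Rightarrow> ('a dual \<Rightarrow> 'a) \<Rightarrow>
   ('a dual \<Rightarrow>\<^sub>0 'f) set" where
  "invariant_functions \<O> L \<Phi> cor =
     {p \<in> torus_functions \<O> L. \<forall>w\<in>weyl \<Phi> cor. \<forall>\<xi>.
        Poly_Mapping.lookup p (w \<xi>) = Poly_Mapping.lookup p \<xi>}"

definition orbit_sum ::
  "'a::{real_inner,heine_borel} dual set \<Rightarrow> ('a dual \<Rightarrow> 'a) \<Rightarrow> 'a dual \<Rightarrow> ('a dual \<Rightarrow>\<^sub>0 'f::field)" where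
  "orbit_sum \<Phi> cor \<xi> = (\<Sum>\<kappa> \<in> {w \<xi> | w. w \<in> weyl \<Phi> cor}. Poly_Mapping.single \<kappa> 1)"

text \<open>The set of \<open>F\<close>-points of \<open>A/W\<close>: the homomorphisms of \<open>\<O>\<close>-algebras from its ring of regular
  functions to \<open>F\<close>.\<close>

definition adj_points ::
  "'f::field set \<Rightarrow> 'a::{real_inner,heine_borel} set \<Rightarrow> 'a dual set \<Rightarrow> ('a dual \<Rightarrow> 'a) \<Rightarrow>
   (('a dual \<Rightarrow>\<^sub>0 'f) \<Rightarrow> 'f) set" where
  "adj_points \<O> L \<Phi> cor =
     {c \<in> extensional (invariant_functions \<O> L \<Phi> cor).
        c \<in> ring_hom (ring_on (invariant_functions \<O> L \<Phi> cor)) (ring_on UNIV) \<and>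
        (\<forall>a\<in>\<O>. c (Poly_Mapping.single 0 a) = a)}"

text \<open>The coordinates \<open>c\<^sub>1, \<dots>, c\<^sub>n\<close> of a point, which identify \<open>A/W\<close> with the product of an affine
  space of dimension \<open>l\<close> and a torus of dimension \<open>n - l\<close>.\<close>

definition adj_coord ::
  "'a::{real_inner,heine_borel} dual set \<Rightarrow> ('a dual \<Rightarrow> 'a) \<Rightarrow> (nat \<Rightarrow> 'a dual) \<Rightarrow>
   (('a dual \<Rightarrow>\<^sub>0 'f::field) \<Rightarrow> 'f) \<Rightarrow> nat \<Rightarrow> 'f" where
  "adj_coord \<Phi> cor \<omega> c i = c (orbit_sum \<Phi> cor (\<omega> i))"

definition val_vector ::
  "'f::field set \<Rightarrow> 'f \<Rightarrow> 'a::{real_inner,heine_borel} dual set \<Rightarrow> ('a dual \<Rightarrow> 'a) \<Rightarrow> nat \<Rightarrow>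
   (nat \<Rightarrow> 'a dual) \<Rightarrow> (('a dual \<Rightarrow>\<^sub>0 'f) \<Rightarrow> 'f) \<Rightarrow> nat \<Rightarrow> ereal" where
  "val_vector \<O> \<pi> \<Phi> cor n \<omega> c = (\<lambda>i\<in>{1..n}. val \<O> \<pi> (adj_coord \<Phi> cor \<omega> c i))"

definition adj_le ::
  "'f::field set \<Rightarrow> 'f \<Rightarrow> 'a::{real_inner,heine_borel} set \<Rightarrow> 'a dual set \<Rightarrow> ('a dual \<Rightarrow> 'a) \<Rightarrow>
   nat \<Rightarrow> (nat \<Rightarrow> 'a dual) \<Rightarrow> nat \<Rightarrow> (nat \<Rightarrow> 'a dual) \<Rightarrow> 'a \<Rightarrow> (('a dual \<Rightarrow>\<^sub>0 'f) \<Rightarrow> 'f) set" where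
  "adj_le \<O> \<pi> L \<Phi> cor l \<alpha> n \<omega> \<mu> =
     {c \<in> adj_points \<O> L \<Phi> cor.
        coroot_le cor l \<alpha> (retr_ext l \<alpha> n \<omega> (val_vector \<O> \<pi> \<Phi> cor n \<omega> c)) \<mu>}"


section \<open>Dimension and codimension\<close>

text \<open>Cosets of \<open>(\<O>\<^sup>\<times>)\<^sup>n\<^sup>-\<^sup>l\<close> in \<open>(F\<^sup>\<times>)\<^sup>n\<^sup>-\<^sup>l\<close>, with coordinates indexed by \<open>{l+1..n}\<close>.\<close>

definition unit_coset :: "'f::field set \<Rightarrow> nat \<Rightarrow> nat \<Rightarrow> (nat \<Rightarrow> 'f) set \<Rightarrow> bool" where
  "unit_coset \<O> l n C \<longleftrightarrow>
     (\<exists>t. (\<forall>i\<in>{l+1..n}. t i \<noteq> 0) \<and> C = (\<Pi>\<^sub>E i\<in>{l+1..n}. {u * t i | u. u \<in> units_on \<O>}))"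

definition adj_box ::
  "'f::field set \<Rightarrow> 'f \<Rightarrow> 'a::{real_inner,heine_borel} set \<Rightarrow> 'a dual set \<Rightarrow> ('a dual \<Rightarrow> 'a) \<Rightarrow>
   nat \<Rightarrow> nat \<Rightarrow> (nat \<Rightarrow> 'a dual) \<Rightarrow> (nat \<Rightarrow> int) \<Rightarrow> (nat \<Rightarrow> 'f) set \<Rightarrow>
   (('a dual \<Rightarrow>\<^sub>0 'f) \<Rightarrow> 'f) set" where
  "adj_box \<O> \<pi> L \<Phi> cor l n \<omega> j C =
     {c \<in> adj_points \<O> L \<Phi> cor.
        (\<forall>i\<in>{1..l}. adj_coord \<Phi> cor \<omega> c i \<in> frac_ideal \<O> \<pi> (j i)) \<and>
        restrict (adj_coord \<Phi> cor \<omega> c) {l+1..n} \<in> C}"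

text \<open>\<open>S\<close> is the subset \<open>P\<^sup>j\<^sup>1 \<times> \<dots> \<times> P\<^sup>j\<^sup>l \<times> C\<close> for some integers \<open>j\<^sub>1, \<dots>, j\<^sub>l\<close>, and \<open>d\<close> is minus
  their sum.\<close>

definition has_k_dim ::
  "'f::field set \<Rightarrow> 'f \<Rightarrow> 'a::{real_inner,heine_borel} set \<Rightarrow> 'a dual set \<Rightarrow> ('a dual \<Rightarrow> 'a) \<Rightarrow>
   nat \<Rightarrow> nat \<Rightarrow> (nat \<Rightarrow> 'a dual) \<Rightarrow> (nat \<Rightarrow> 'f) set \<Rightarrow>
   (('a dual \<Rightarrow>\<^sub>0 'f) \<Rightarrow> 'f) set \<Rightarrow> int \<Rightarrow> bool" where
  "has_k_dim \<O> \<pi> L \<Phi> cor l n \<omega> C S d \<longleftrightarrow>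
     unit_coset \<O> l n C \<and>
     (\<exists>j. S = adj_box \<O> \<pi> L \<Phi> cor l n \<omega> j C \<and> d = - (\<Sum>i=1..l. j i))"

definition has_k_codim ::
  "'f::field set \<Rightarrow> 'f \<Rightarrow> 'a::{real_inner,heine_borel} set \<Rightarrow> 'a dual set \<Rightarrow> ('a dual \<Rightarrow> 'a) \<Rightarrow>
   nat \<Rightarrow> nat \<Rightarrow> (nat \<Rightarrow> 'a dual) \<Rightarrow>
   (('a dual \<Rightarrow>\<^sub>0 'f) \<Rightarrow> 'f) set \<Rightarrow> (('a dual \<Rightarrow>\<^sub>0 'f) \<Rightarrow> 'f) set \<Rightarrow> int \<Rightarrow> bool" where
  "has_k_codim \<O> \<pi> L \<Phi> cor l n \<omega> S T d \<longleftrightarrow>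
     S \<subseteq> T \<and>
     (\<exists>C dS dT. has_k_dim \<O> \<pi> L \<Phi> cor l n \<omega> C S dS \<and>
                has_k_dim \<O> \<pi> L \<Phi> cor l n \<omega> C T dT \<and> d = dT - dS)"

end

theory Submission
  imports Defs
begin

text \<open>
  Write \<open>a\<^sub>i\<close> for the simple coroots.  The point is that the subset belonging to a Newton point \<open>\<mu>\<close>
  is cut out by conditions on the coordinates one at a time, although it is defined through the
  retraction \<open>r\<close>, which mixes the coordinates.  Three facts give this.

  The order: \<open>x \<le> y\<close> means \<open>\<langle>\<omega>\<^sub>i, x\<rangle> \<le> \<langle>\<omega>\<^sub>i, y\<rangle>\<close> for \<open>i \<le> l\<close> and equality for \<open>i > l\<close>, because the
  \<open>\<omega>\<^sub>i\<close> form a basis of the dual space and the simple coroots are the first members of the dual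
  basis.  The characters \<open>\<omega>\<^sub>i\<close> span because subtracting from a character the right integral
  combination of the first \<open>l\<close> of them leaves a character of \<open>D\<close>.

  The retraction: \<open>r(x)\<close> is the least dominant point above \<open>x\<close>, so that \<open>r(x) \<le> \<mu>\<close> and \<open>x \<le> \<mu>\<close> are
  equivalent for dominant \<open>\<mu>\<close> (\<open>retr_le_iff\<close>).  This comes from the optimality conditions for a
  closest point of a cone, together with the fact that simple coroots make obtuse angles.  Since the
  coordinates \<open>\<langle>\<omega>\<^sub>i, y\<rangle>\<close>, \<open>i \<le> l\<close>, of a dominant \<open>y\<close> are bounded below in terms of its central
  coordinates, raising a coordinate of \<open>x\<close> that lies below this bound up to the bound does not
  change \<open>r(x)\<close>.  This gives the continuous extension of \<open>r\<close> to coordinates \<open>-\<infinity>\<close>, and the same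
  equivalence for it (\<open>retr_ext_le_iff\<close>).

  The coordinates: for \<open>i > l\<close> the function \<open>c\<^sub>i\<close> is the character \<open>\<omega>\<^sub>i\<close> of \<open>D\<close>, hence invertible,
  and its values have finite valuation, and \<open>\<langle>\<omega>\<^sub>i, \<mu>\<rangle>\<close> is an integer because \<open>\<mu>\<close> differs from a cocharacter by a combination of
  coroots.  For \<open>i \<le> l\<close> the valuation of \<open>c\<^sub>i\<close> is an integer or \<open>-\<infinity>\<close>, so the bound \<open>\<langle>\<omega>\<^sub>i, \<mu>\<rangle>\<close> may be
  replaced by its integral part.  Hence the subset of \<open>\<mu>\<close> is the box with exponents
  \<open>- [\<langle>\<omega>\<^sub>i, \<mu>\<rangle>]\<close> (\<open>adj_le_eq_box\<close>), and if \<open>\<nu> \<le> \<mu>\<close> the two cosets agree.  Another extension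
  \<open>\<omega>'\<^sub>i\<close> differs from \<open>\<omega>\<^sub>i\<close> by a character of \<open>D\<close>, which takes the same integral value on \<open>\<mu>\<close> and
  \<open>\<nu>\<close>, so both integral parts move by the same integer.
\<close>

section \<open>Linear algebra\<close>

text \<open>Orthogonal projection onto a finitely generated subspace of any real inner product space; \<open>\<aa>\<close>
  may be zero and so is not an instance of \<open>euclidean_space\<close>.\<close>

lemma orthogonal_decomposition:
  fixes S :: "'a::real_inner set"
  assumes "finite S"
  obtains s where "s \<in> span S" "\<And>y. y \<in> span S \<Longrightarrow> (x - s) \<bullet> y = 0"
proof -
  obtain C where C: "finite C" "span C = span S" "pairwise orthogonal C"
    using basis_orthogonal[OF assms] by blast
  define s where "s = (\<Sum>c\<in>C. (x \<bullet> c / (c \<bullet> c)) *\<^sub>R c)"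
  have perp: "(x - s) \<bullet> y = 0" if "y \<in> C" for y
  proof -
    have "s \<bullet> y = (\<Sum>c\<in>C. if c = y then x \<bullet> y else 0)"
      unfolding s_def inner_sum_left
      using C(3) that by (intro sum.cong) (auto simp: pairwise_def orthogonal_def)
    then show ?thesis
      using C(1) that by (simp add: inner_diff_left)
  qed
  have "(x - s) \<bullet> y = 0" if "y \<in> span C" for y
    using that by (induction rule: span_induct_alt) (simp_all add: inner_add_right perp)
  moreover have "s \<in> span C"
    unfolding s_def by (intro span_sum span_scale span_base)
  ultimately show ?thesis
    using that C(2) by metis
qed

lemma separating_vector:
  fixes S :: "'a::real_inner set"
  assumes "finite S" "x \<notin> span S"
  obtains w where "w \<bullet> x = 1" "\<And>y. y \<in> span S \<Longrightarrow> w \<bullet> y = 0"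
proof -
  obtain s where s: "s \<in> span S" "\<And>y. y \<in> span S \<Longrightarrow> (x - s) \<bullet> y = 0"
    using orthogonal_decomposition[OF assms(1)] by blast
  define t where "t = x - s"
  have t: "t \<noteq> 0" "t \<bullet> t = t \<bullet> x"
    using s assms(2) by (auto simp: t_def inner_diff_right)
  then have tx: "t \<bullet> x \<noteq> 0"
    by (metis inner_eq_zero_iff)
  show ?thesis
  proof
    show "(t /\<^sub>R (t \<bullet> x)) \<bullet> x = 1"
      using tx by simp
    show "(t /\<^sub>R (t \<bullet> x)) \<bullet> y = 0" if "y \<in> span S" for y
      using s(2)[OF that] by (simp add: t_def)
  qed
qed

lemma span_image_finiteE:
  fixes f :: "'i \<Rightarrow> 'b::real_vector"
  assumes "finite I" "v \<in> span (f ` I)"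
  obtains u where "v = (\<Sum>i\<in>I. u i *\<^sub>R f i)"
proof -
  have "\<exists>u. v = (\<Sum>i\<in>I. u i *\<^sub>R f i)"
    using assms(2)
  proof (induction rule: span_induct_alt)
    case base
    show ?case by (rule exI[of _ "\<lambda>_. 0"]) simp
  next
    case (step c x y)
    then obtain i u where i: "i \<in> I" "x = f i" and u: "y = (\<Sum>i\<in>I. u i *\<^sub>R f i)" by auto
    have "c *\<^sub>R x + y = (\<Sum>j\<in>I. (if j = i then c *\<^sub>R f i else 0)) + (\<Sum>j\<in>I. u j *\<^sub>R f j)"
      using i u assms(1) by simp
    also have "\<dots> = (\<Sum>j\<in>I. (u j + (if j = i then c else 0)) *\<^sub>R f j)"
      unfolding sum.distrib[symmetric] by (intro sum.cong) (auto simp: algebra_simps)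
    finally show ?case
      by (rule exI[of _ "\<lambda>j. u j + (if j = i then c else 0)"])
  qed
  then show ?thesis using that by blast
qed

lemma independent_family_coefficients:
  fixes f :: "'i \<Rightarrow> 'b::real_vector"
  assumes "finite I" "inj_on f I" "independent (f ` I)" "(\<Sum>i\<in>I. c i *\<^sub>R f i) = 0" "i \<in> I"
  shows "c i = 0"
proof -
  define u where "u = c \<circ> the_inv_into I f"
  have u: "u (f j) = c j" if "j \<in> I" for j
    using that assms(2) by (simp add: u_def the_inv_into_f_f)
  have "(\<Sum>v\<in>f ` I. u v *\<^sub>R v) = 0"
    using assms(2,4) u by (simp add: sum.reindex)
  then have "u (f i) = 0"
    using independentD[OF assms(3) _ subset_refl] assms(1,5) by blast
  then show ?thesis using u assms(5) by simp
qed

text \<open>Expanding every vector through \<open>n\<close> functionals and \<open>n = dim\<close> vectors forces the two families to be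
  dual: the vectors span, and a linear relation among them would let fewer than \<open>n\<close> of them span.\<close>

lemma dual_of_expansion:
  fixes e :: "nat \<Rightarrow> 'b::real_vector" and f :: "nat \<Rightarrow> 'b \<Rightarrow> real"
  assumes expand: "\<And>x. x = (\<Sum>i=1..n. f i x *\<^sub>R e i)" and n: "n = dim (UNIV :: 'b set)"
    and ij: "i \<in> {1..n}" "j \<in> {1..n}"
  shows "f i (e j) = (if i = j then 1 else 0)"
proof -
  have indep: "c i = 0" if c: "(\<Sum>i=1..n. c i *\<^sub>R e i) = 0" and i: "i \<in> {1..n}" for c i
  proof (rule ccontr)
    assume ci: "c i \<noteq> 0"
    define T where "T = e ` ({1..n} - {i})"
    have T: "e k \<in> span T" if "k \<in> {1..n}" "k \<noteq> i" for k
      using that by (intro span_base) (auto simp: T_def)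
    have "c i *\<^sub>R e i = - (\<Sum>k\<in>{1..n} - {i}. c k *\<^sub>R e k)"
      using c i by (simp add: sum.remove[of _ i] eq_neg_iff_add_eq_0)
    moreover have "- (\<Sum>k\<in>{1..n} - {i}. c k *\<^sub>R e k) \<in> span T"
      using T by (intro span_neg span_sum span_scale) auto
    ultimately have "c i *\<^sub>R e i \<in> span T" by (simp only:)
    from span_scale[OF this, of "1 / c i"] ci have ei: "e i \<in> span T" by simp
    have "x \<in> span T" for x
      by (subst expand) (intro span_sum span_scale, use T ei in metis)
    then have "dim (UNIV :: 'b set) \<le> card T"
      by (intro dim_le_card) (auto simp: T_def)
    also have "card T \<le> card ({1..n} - {i})"
      unfolding T_def by (rule card_image_le) simp
    also have "\<dots> < n" using i by simp
    finally show False using n by simp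
  qed
  have "(\<Sum>k=1..n. (f k (e j) - (if k = j then 1 else 0)) *\<^sub>R e k)
      = (\<Sum>k=1..n. f k (e j) *\<^sub>R e k) - (\<Sum>k=1..n. if k = j then e j else 0)"
    unfolding sum_subtractf[symmetric] by (intro sum.cong) (auto simp: algebra_simps)
  also have "\<dots> = 0" using expand[of "e j"] ij by simp
  finally show ?thesis
    using indep[of "\<lambda>k. f k (e j) - (if k = j then 1 else 0)" i] ij by simp
qed

section \<open>Dominant chambers and the closest dominant point\<close>

text \<open>The geometry that the retraction needs: linear forms \<open>\<omega> 1, \<dots>, \<omega> n\<close> with dual basis \<open>e\<close>, whose
  first \<open>l\<close> vectors are the simple coroots; these make obtuse angles, and the simple roots are
  positive multiples of the inner products with them.\<close>

locale chamber =
  fixes l n :: nat and \<alpha> \<omega> :: "nat \<Rightarrow> 'a::{real_inner,heine_borel} dual"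
    and cor :: "'a dual \<Rightarrow> 'a" and e :: "nat \<Rightarrow> 'a"
  assumes l_le_n: "l \<le> n"
    and root_inner: "i \<in> {1..l} \<Longrightarrow> \<exists>k>0. \<forall>x. \<alpha> i x = k * (x \<bullet> cor (\<alpha> i))"
    and obtuse: "i \<in> {1..l} \<Longrightarrow> j \<in> {1..l} \<Longrightarrow> i \<noteq> j \<Longrightarrow> cor (\<alpha> i) \<bullet> cor (\<alpha> j) \<le> 0"
    and expand: "x = (\<Sum>i=1..n. \<omega> i x *\<^sub>R e i)"
    and weight_e: "i \<in> {1..n} \<Longrightarrow> j \<in> {1..n} \<Longrightarrow> \<omega> i (e j) = (if i = j then 1 else 0)"
    and e_coroot: "i \<in> {1..l} \<Longrightarrow> e i = cor (\<alpha> i)"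
begin

abbreviation a where "a i \<equiv> cor (\<alpha> i)"
abbreviation K where "K \<equiv> dom_cone l \<alpha>"
abbreviation le where "le \<equiv> coroot_le cor l \<alpha>"

lemma weight_sum:
  assumes "i \<in> {1..n}"
  shows "\<omega> i (\<Sum>j=1..n. t j *\<^sub>R e j) = t i"
proof -
  have "\<omega> i (\<Sum>j=1..n. t j *\<^sub>R e j) = (\<Sum>j=1..n. if j = i then t i else 0)"
    unfolding blinfun.sum_right blinfun.scaleR_right
    using assms by (intro sum.cong) (auto simp: weight_e)
  then show ?thesis using assms by simp
qed

lemma weight_coroot_sum:
  assumes "i \<in> {1..n}"
  shows "\<omega> i (\<Sum>j=1..l. t j *\<^sub>R a j) = (if i \<le> l then t i else 0)"
proof -
  have "\<omega> i (\<Sum>j=1..l. t j *\<^sub>R a j) = (\<Sum>j=1..l. if j = i then t i else 0)"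
    unfolding blinfun.sum_right blinfun.scaleR_right
    using assms l_le_n by (intro sum.cong) (auto simp: weight_e e_coroot[symmetric])
  then show ?thesis using assms by auto
qed

lemma coords_eqI:
  assumes "\<And>i. i \<in> {1..n} \<Longrightarrow> \<omega> i x = \<omega> i y"
  shows "x = y"
proof -
  have "x = (\<Sum>i=1..n. \<omega> i x *\<^sub>R e i)" by (rule expand)
  also have "\<dots> = (\<Sum>i=1..n. \<omega> i y *\<^sub>R e i)" using assms by simp
  also have "\<dots> = y" by (rule expand[symmetric])
  finally show ?thesis .
qed

lemma coroot_combination:
  assumes "\<And>k. k \<in> {l+1..n} \<Longrightarrow> \<omega> k v = 0"
  shows "v = (\<Sum>i=1..l. \<omega> i v *\<^sub>R a i)"
proof (rule coords_eqI)
  fix i assume "i \<in> {1..n}"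
  then show "\<omega> i v = \<omega> i (\<Sum>i=1..l. \<omega> i v *\<^sub>R a i)"
    using assms[of i] weight_coroot_sum[of i "\<lambda>i. \<omega> i v"] by auto
qed

lemma le_iff_weights:
  "le x y \<longleftrightarrow> (\<forall>i\<in>{1..l}. \<omega> i x \<le> \<omega> i y) \<and> (\<forall>i\<in>{l+1..n}. \<omega> i x = \<omega> i y)"
proof
  assume "le x y"
  then obtain t where t: "\<forall>i\<in>{1..l}. 0 \<le> t i" "y - x = (\<Sum>i=1..l. t i *\<^sub>R a i)"
    by (auto simp: coroot_le_def)
  have diff: "\<omega> i y - \<omega> i x = (if i \<le> l then t i else 0)" if "i \<in> {1..n}" for i
    using weight_coroot_sum[OF that, of t] unfolding t(2)[symmetric] blinfun.diff_right .
  show "(\<forall>i\<in>{1..l}. \<omega> i x \<le> \<omega> i y) \<and> (\<forall>i\<in>{l+1..n}. \<omega> i x = \<omega> i y)"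
  proof (intro conjI ballI)
    fix i assume "i \<in> {1..l}"
    then show "\<omega> i x \<le> \<omega> i y" using diff[of i] bspec[OF t(1), of i] l_le_n by auto
  next
    fix i assume "i \<in> {l+1..n}"
    then show "\<omega> i x = \<omega> i y" using diff[of i] by auto
  qed
next
  assume *: "(\<forall>i\<in>{1..l}. \<omega> i x \<le> \<omega> i y) \<and> (\<forall>i\<in>{l+1..n}. \<omega> i x = \<omega> i y)"
  then have v: "y - x = (\<Sum>i=1..l. \<omega> i (y - x) *\<^sub>R a i)"
    by (intro coroot_combination) (auto simp: blinfun.diff_right)
  show "le x y"
    unfolding coroot_le_def
  proof (intro exI conjI)
    show "\<forall>i\<in>{1..l}. 0 \<le> \<omega> i (y - x)"
      using * by (simp add: blinfun.diff_right)
  qed (rule v)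
qed

lemma le_refl: "le x x"
  by (simp add: le_iff_weights)

lemma le_antisym:
  assumes "le x y" "le y x"
  shows "x = y"
proof (rule coords_eqI)
  fix i assume "i \<in> {1..n}"
  then show "\<omega> i x = \<omega> i y"
    using assms by (cases "i \<le> l") (auto simp: le_iff_weights intro: order_antisym)
qed

lemma mem_dom: "x \<in> K \<longleftrightarrow> (\<forall>i\<in>{1..l}. 0 \<le> x \<bullet> a i)"
proof -
  have "0 \<le> \<alpha> i x \<longleftrightarrow> 0 \<le> x \<bullet> a i" if "i \<in> {1..l}" for i
    using root_inner[OF that] by (auto simp: zero_le_mult_iff)
  then show ?thesis by (auto simp: dom_cone_def)
qed

lemma closed_dom: "closed K" and convex_dom: "convex K" and dom_nonempty: "K \<noteq> {}"
proof -
  have eq: "K = (\<Inter>i\<in>{1..l}. {x. a i \<bullet> x \<ge> 0})"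
    by (auto simp: mem_dom inner_commute)
  show "closed K" "convex K"
    unfolding eq by (auto intro!: closed_INT convex_INT closed_halfspace_ge convex_halfspace_ge)
  have "0 \<in> K" by (simp add: mem_dom)
  then show "K \<noteq> {}" by blast
qed

text \<open>The key consequence of obtuseness: a combination \<open>v\<close> of the \<open>a i\<close> that has non-negative inner
  product with every \<open>a i\<close> of negative coefficient has no negative coefficient at all.  Splitting
  \<open>v = p - u\<close> into its positive and negative parts, the hypothesis gives \<open>v \<bullet> u \<ge> 0\<close> and obtuseness
  gives \<open>p \<bullet> u \<le> 0\<close>, so \<open>u \<bullet> u \<le> 0\<close>.\<close>

lemma coefficients_nonneg:
  fixes s :: "nat \<Rightarrow> real"
  defines "v \<equiv> \<Sum>i=1..l. s i *\<^sub>R a i"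
  assumes neg: "\<And>i. i \<in> {1..l} \<Longrightarrow> s i < 0 \<Longrightarrow> 0 \<le> v \<bullet> a i"
    and i: "i \<in> {1..l}"
  shows "0 \<le> s i"
proof -
  define p where "p i = max (s i) 0" for i
  define m where "m i = max (- s i) 0" for i
  define u where "u = (\<Sum>i=1..l. m i *\<^sub>R a i)"
  have v: "v = (\<Sum>i=1..l. p i *\<^sub>R a i) - u"
    unfolding v_def u_def sum_subtractf[symmetric]
    by (intro sum.cong) (auto simp: p_def m_def max_def algebra_simps)
  have "0 \<le> (\<Sum>i=1..l. m i * (v \<bullet> a i))"
  proof (rule sum_nonneg)
    fix i assume "i \<in> {1..l}"
    then show "0 \<le> m i * (v \<bullet> a i)"
      using neg[of i] by (cases "s i < 0") (auto simp: m_def max_def mult_le_0_iff)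
  qed
  also have "\<dots> = v \<bullet> u"
    by (simp add: u_def inner_sum_right)
  also have "\<dots> = (\<Sum>i=1..l. p i *\<^sub>R a i) \<bullet> u - u \<bullet> u"
    by (subst v) (simp add: inner_diff_left)
  finally have 1: "u \<bullet> u \<le> (\<Sum>i=1..l. p i *\<^sub>R a i) \<bullet> u" by simp
  have "(\<Sum>i=1..l. p i *\<^sub>R a i) \<bullet> u = (\<Sum>i=1..l. \<Sum>j=1..l. p i * m j * (a i \<bullet> a j))"
    unfolding u_def inner_sum_left
    unfolding inner_sum_right by (simp add: mult.assoc mult.left_commute)
  also have "\<dots> \<le> 0"
  proof (intro sum_nonpos)
    fix i j assume ij: "i \<in> {1..l}" "j \<in> {1..l}"
    show "p i * m j * (a i \<bullet> a j) \<le> 0"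
    proof (cases "i = j")
      case True
      then have "p i * m j = 0" by (cases "s i < 0") (simp_all add: p_def m_def)
      then show ?thesis by (simp only: mult_zero_left)
    next
      case False
      then show ?thesis
        using obtuse[OF ij False] by (intro mult_nonneg_nonpos mult_nonneg_nonneg) (simp_all add: p_def m_def)
    qed
  qed
  finally have "u \<bullet> u \<le> 0"
    using 1 by linarith
  then have "u = 0"
    by (metis inner_ge_zero inner_eq_zero_iff order_antisym)
  then have "m i = 0"
    using weight_coroot_sum[of i m] i l_le_n unfolding u_def[symmetric] by simp
  then show ?thesis
    using max.cobounded1[of "- s i" 0] by (simp add: m_def)
qed

lemma inner_dual:
  assumes "i \<in> {1..l}"
  obtains w where "\<And>j. j \<in> {1..l} \<Longrightarrow> w \<bullet> a j = (if j = i then 1 else 0)"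
proof -
  have *: "\<omega> i v = 0" if "v \<in> span (a ` ({1..l} - {i}))" for v
    using that assms l_le_n
    by (induction rule: span_induct_alt)
       (auto simp: blinfun.add_right blinfun.scaleR_right weight_e e_coroot[symmetric])
  have "\<omega> i (a i) = 1"
    using assms l_le_n by (auto simp: weight_e e_coroot[symmetric])
  with * have "a i \<notin> span (a ` ({1..l} - {i}))" by fastforce
  then obtain w where w: "w \<bullet> a i = 1" "\<And>y. y \<in> span (a ` ({1..l} - {i})) \<Longrightarrow> w \<bullet> y = 0"
    using separating_vector[of "a ` ({1..l} - {i})" "a i"] by auto
  then show ?thesis
    by (intro that[of w]) (auto intro: w(2)[OF span_base])
qed

text \<open>Farkas' lemma for a cone with linearly independent walls.  The vectors orthogonal to all \<open>a i\<close> lie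
  in the cone together with their negatives, so \<open>q\<close> is a combination of the \<open>a i\<close>; its
  coefficients are inner products with a dual family, which lies in the cone.\<close>

lemma dual_cone:
  assumes "\<And>y. y \<in> K \<Longrightarrow> 0 \<le> q \<bullet> y"
  obtains t where "\<And>i. i \<in> {1..l} \<Longrightarrow> 0 \<le> t i" "q = (\<Sum>i=1..l. t i *\<^sub>R a i)"
proof -
  obtain s where s: "s \<in> span (a ` {1..l})" "\<And>y. y \<in> span (a ` {1..l}) \<Longrightarrow> (q - s) \<bullet> y = 0"
    using orthogonal_decomposition[of "a ` {1..l}" q] by auto
  have "(q - s) \<bullet> a i = 0" if "i \<in> {1..l}" for i
    using that by (intro s(2) span_base) auto
  then have "s - q \<in> K"
    by (simp add: mem_dom inner_diff_left)
  then have "0 \<le> q \<bullet> (s - q)" by (rule assms)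
  also have "q \<bullet> (s - q) = - ((q - s) \<bullet> (q - s))"
    using s(2)[OF s(1)] by (simp add: inner_diff_left inner_diff_right inner_commute)
  finally have "(q - s) \<bullet> (q - s) \<le> 0" by linarith
  then have "q = s"
    by (metis inner_ge_zero inner_eq_zero_iff order_antisym right_minus_eq)
  with s(1) obtain t where t: "q = (\<Sum>i=1..l. t i *\<^sub>R a i)"
    by (metis span_image_finiteE finite_atLeastAtMost)
  have "0 \<le> t i" if i: "i \<in> {1..l}" for i
  proof -
    obtain w where w: "\<And>j. j \<in> {1..l} \<Longrightarrow> w \<bullet> a j = (if j = i then 1 else 0)"
      using inner_dual[OF i] by blast
    have "q \<bullet> w = (\<Sum>j=1..l. if j = i then t i else 0)"
      unfolding t inner_sum_left using w by (intro sum.cong) (auto simp: inner_commute)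
    then have "q \<bullet> w = t i" using i by simp
    moreover have "w \<in> K" using w by (auto simp: mem_dom)
    ultimately show ?thesis using assms by metis
  qed
  then show ?thesis using that t by blast
qed

lemma retr_in_dom: "retr l \<alpha> x \<in> K"
  unfolding retr_def using closed_dom dom_nonempty by (rule closest_point_in_set)

text \<open>Optimality conditions: the closest point of the cone is reached from \<open>x\<close> by moving in the
  directions \<open>a i\<close>, and only along those for which the closest point lies on the wall.\<close>

lemma retr_kkt:
  obtains t where "\<And>i. i \<in> {1..l} \<Longrightarrow> 0 \<le> t i"
    "retr l \<alpha> x - x = (\<Sum>i=1..l. t i *\<^sub>R a i)"
    "\<And>i. i \<in> {1..l} \<Longrightarrow> t i = 0 \<or> retr l \<alpha> x \<bullet> a i = 0"
proof -
  define p where "p = retr l \<alpha> x"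
  have pK: "p \<in> K" unfolding p_def by (rule retr_in_dom)
  have dot: "(x - p) \<bullet> (y - p) \<le> 0" if "y \<in> K" for y
    unfolding p_def retr_def using convex_dom closed_dom that by (rule closest_point_dot)
  \<comment> \<open>The ray through \<open>p\<close> stays in the cone in both directions near \<open>p\<close>, so \<open>x - p\<close> is orthogonal to it.\<close>
  have "2 *\<^sub>R p \<in> K" "0 \<in> K" using pK by (auto simp: mem_dom)
  from dot[OF this(1)] dot[OF this(2)] have orth: "(x - p) \<bullet> p = 0"
    by (simp add: inner_diff_right scaleR_2 inner_add_right)
  have nonneg: "0 \<le> (p - x) \<bullet> y" if "y \<in> K" for y
    using dot[OF that] orth by (simp add: inner_diff_right inner_diff_left)
  obtain t where t: "\<And>i. i \<in> {1..l} \<Longrightarrow> 0 \<le> t i" "p - x = (\<Sum>i=1..l. t i *\<^sub>R a i)"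
    using dual_cone[OF nonneg] by blast
  have "(p - x) \<bullet> p = (\<Sum>i=1..l. t i * (p \<bullet> a i))"
    unfolding t(2) inner_sum_left by (simp add: inner_commute)
  then have "(\<Sum>i=1..l. t i * (p \<bullet> a i)) = (p - x) \<bullet> p" ..
  also have "\<dots> = 0" using orth by (simp add: inner_diff_left)
  finally have "\<forall>i\<in>{1..l}. t i * (p \<bullet> a i) = 0"
    using t(1) pK by (subst (asm) sum_nonneg_eq_0_iff) (auto simp: mem_dom)
  then show ?thesis using that[of t] t unfolding p_def by (simp add: Ball_def)
qed

text \<open>The retraction is the least dominant point above \<open>x\<close>.  If \<open>\<mu>\<close> is dominant and above \<open>x\<close>, a
  coefficient of \<open>\<mu> - r(x)\<close> can only be negative at an \<open>i\<close> where \<open>r(x)\<close> was moved away from \<open>x\<close>;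
  there \<open>r(x)\<close> lies on the wall, so \<open>(\<mu> - r(x)) \<bullet> a i \<ge> 0\<close> and \<open>coefficients_nonneg\<close> applies.\<close>

lemma retr_le_iff:
  assumes "\<mu> \<in> K"
  shows "le (retr l \<alpha> x) \<mu> \<longleftrightarrow> le x \<mu>"
proof -
  define p where "p = retr l \<alpha> x"
  obtain t where t: "\<And>i. i \<in> {1..l} \<Longrightarrow> 0 \<le> t i"
    "p - x = (\<Sum>i=1..l. t i *\<^sub>R a i)"
    "\<And>i. i \<in> {1..l} \<Longrightarrow> t i = 0 \<or> p \<bullet> a i = 0"
    using that by (rule retr_kkt[of x, folded p_def])
  have wp: "\<omega> i p = \<omega> i x + (if i \<le> l then t i else 0)" if "i \<in> {1..n}" for i
    using weight_coroot_sum[OF that, of t] unfolding t(2)[symmetric] blinfun.diff_right by linarith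
  have "le p \<mu>" if "le x \<mu>"
  proof -
    have cent: "\<omega> i p = \<omega> i \<mu>" if "i \<in> {l+1..n}" for i
      using \<open>le x \<mu>\<close> that wp[of i] by (auto simp: le_iff_weights)
    define s where "s i = \<omega> i (\<mu> - p)" for i
    have s: "\<mu> - p = (\<Sum>i=1..l. s i *\<^sub>R a i)"
      unfolding s_def using cent by (intro coroot_combination) (auto simp: blinfun.diff_right)
    have "0 \<le> s i" if i: "i \<in> {1..l}" for i
    proof (rule coefficients_nonneg[OF _ i])
      fix j assume j: "j \<in> {1..l}" "s j < 0"
      have "\<omega> j x \<le> \<omega> j \<mu>" using \<open>le x \<mu>\<close> j by (auto simp: le_iff_weights)
      then have "t j \<noteq> 0"
        using wp[of j] j l_le_n by (auto simp: s_def blinfun.diff_right)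
      then have "p \<bullet> a j = 0" using t(3) j by blast
      then show "0 \<le> (\<Sum>i=1..l. s i *\<^sub>R a i) \<bullet> a j"
        unfolding s[symmetric] using assms j by (auto simp: inner_diff_left mem_dom)
    qed
    then show ?thesis
      unfolding le_iff_weights using cent by (simp add: s_def blinfun.diff_right)
  qed
  moreover have "le x \<mu>" if "le p \<mu>"
    unfolding le_iff_weights
  proof (intro conjI ballI)
    fix i assume "i \<in> {1..l}"
    then show "\<omega> i x \<le> \<omega> i \<mu>"
      using bspec[OF conjunct1[OF that[unfolded le_iff_weights]], of i] wp[of i] t(1)[of i] l_le_n by auto
  next
    fix i assume "i \<in> {l+1..n}"
    then show "\<omega> i x = \<omega> i \<mu>"
      using that wp[of i] by (auto simp: le_iff_weights)
  qed
  ultimately show ?thesis unfolding p_def by (rule iffI[rotated])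
qed

lemma retr_eqI:
  assumes "\<And>\<mu>. \<mu> \<in> K \<Longrightarrow> le x \<mu> \<longleftrightarrow> le y \<mu>"
  shows "retr l \<alpha> x = retr l \<alpha> y"
proof -
  have *: "le x (retr l \<alpha> x)" for x
    using retr_le_iff[OF retr_in_dom] le_refl by metis
  have "le (retr l \<alpha> x) (retr l \<alpha> y)"
    using retr_le_iff[OF retr_in_dom] assms[OF retr_in_dom] * by metis
  moreover have "le (retr l \<alpha> y) (retr l \<alpha> x)"
    using retr_le_iff[OF retr_in_dom] assms[OF retr_in_dom] * by metis
  ultimately show ?thesis by (rule le_antisym)
qed

text \<open>A dominant \<open>y\<close> is the sum of the vector \<open>z\<close> orthogonal to all coroots with the same central
  coordinates and a combination of coroots whose coefficients are non-negative by
  \<open>coefficients_nonneg\<close>.  So \<open>\<omega> i y\<close> is at least \<open>\<omega> i z\<close>, which is linear in the central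
  coordinates.\<close>

lemma central_lower_bound:
  obtains b where "\<And>i y. i \<in> {1..l} \<Longrightarrow> y \<in> K \<Longrightarrow> (\<Sum>j=l+1..n. b i j * \<omega> j y) \<le> \<omega> i y"
proof -
  have "\<exists>f. (\<forall>i\<in>{1..l}. f \<bullet> a i = 0) \<and> (\<forall>k\<in>{l+1..n}. \<omega> k f = \<omega> k (e j))" for j
  proof -
    obtain s where s: "s \<in> span (a ` {1..l})" "\<And>y. y \<in> span (a ` {1..l}) \<Longrightarrow> (e j - s) \<bullet> y = 0"
      using orthogonal_decomposition[of "a ` {1..l}" "e j"] by auto
    obtain t where t: "s = (\<Sum>i=1..l. t i *\<^sub>R a i)"
      using s(1) by (metis span_image_finiteE finite_atLeastAtMost)
    have "\<omega> k s = 0" if "k \<in> {l+1..n}" for k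
      using weight_coroot_sum[of k t] that by (simp add: t)
    then show ?thesis
      using s(2) by (intro exI[of _ "e j - s"]) (auto simp: blinfun.diff_right span_base)
  qed
  then obtain f where f: "\<And>i j. i \<in> {1..l} \<Longrightarrow> f j \<bullet> a i = 0"
    "\<And>k j. k \<in> {l+1..n} \<Longrightarrow> \<omega> k (f j) = \<omega> k (e j)" by metis
  have "(\<Sum>j=l+1..n. \<omega> i (f j) * \<omega> j y) \<le> \<omega> i y" if i: "i \<in> {1..l}" and y: "y \<in> K" for i y
  proof -
    define z where "z = (\<Sum>j=l+1..n. \<omega> j y *\<^sub>R f j)"
    have "\<omega> k z = \<omega> k y" if k: "k \<in> {l+1..n}" for k
    proof -
      have "\<omega> k z = (\<Sum>j=l+1..n. if j = k then \<omega> k y else 0)"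
        unfolding z_def blinfun.sum_right blinfun.scaleR_right
        using k by (intro sum.cong) (auto simp: f(2) weight_e)
      then show ?thesis using k by simp
    qed
    then have v: "y - z = (\<Sum>i=1..l. \<omega> i (y - z) *\<^sub>R a i)"
      by (intro coroot_combination) (auto simp: blinfun.diff_right)
    have "0 \<le> \<omega> i (y - z)"
    proof (rule coefficients_nonneg[OF _ i])
      fix j assume "j \<in> {1..l}"
      then show "0 \<le> (\<Sum>i=1..l. \<omega> i (y - z) *\<^sub>R a i) \<bullet> a j"
        unfolding v[symmetric] using y f(1) by (simp add: z_def inner_diff_left inner_sum_left mem_dom)
    qed
    then show ?thesis
      by (simp add: z_def blinfun.diff_right blinfun.sum_right blinfun.scaleR_right mult.commute)
  qed
  then show ?thesis by (rule that)
qed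

end

section \<open>Extending the retraction to infinite coordinates\<close>

lemma continuous_on_real_of_ereal_compose:
  fixes f :: "'x::topological_space \<Rightarrow> ereal"
  assumes "continuous_on S f" "\<And>x. x \<in> S \<Longrightarrow> \<bar>f x\<bar> \<noteq> \<infinity>"
  shows "continuous_on S (\<lambda>x. real_of_ereal (f x))"
  by (rule continuous_on_compose2[OF continuous_on_real assms(1)]) (use assms(2) in force)

lemma tendsto_coordinatewise:
  fixes f :: "'x \<Rightarrow> 'i \<Rightarrow> 'b::topological_space"
  assumes "\<And>i. ((\<lambda>x. f x i) \<longlongrightarrow> g i) F"
  shows "(f \<longlongrightarrow> g) F"
proof -
  have "limitin (product_topology (\<lambda>i. euclidean) UNIV) f g F"
    unfolding limitin_componentwise using assms by simp
  then show ?thesis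
    by (simp add: euclidean_product_topology)
qed

context chamber
begin

lemma weight_coords_mem: "weight_coords n \<omega> x \<in> ext_space l n"
  by (auto simp: weight_coords_def ext_space_def)

lemma ext_space_less: "d \<in> ext_space l n \<Longrightarrow> i \<in> {1..n} \<Longrightarrow> d i < \<infinity>"
  and ext_space_finite: "d \<in> ext_space l n \<Longrightarrow> i \<in> {l+1..n} \<Longrightarrow> \<bar>d i\<bar> \<noteq> \<infinity>"
  unfolding ext_space_def by (force dest: PiE_mem[of _ _ _ i] split: if_splits)+

text \<open>Truncating the coordinates from below at \<open>-k\<close> approximates any point of the extended space; this
  makes the continuous extension of the retraction unique.\<close>

lemma weight_coords_dense:
  assumes d: "d \<in> ext_space l n"
  obtains x where "(\<lambda>k. weight_coords n \<omega> (x k)) \<longlonglongrightarrow> d"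
proof
  define x where "x k = (\<Sum>i=1..n. real_of_ereal (max (d i) (ereal (- real k))) *\<^sub>R e i)" for k
  have lim: "(\<lambda>k. max (d i) (ereal (- real k))) \<longlonglongrightarrow> max (d i) (-\<infinity>)" for i
  proof (intro tendsto_max tendsto_const)
    have "(\<lambda>k. - ereal (real k)) \<longlonglongrightarrow> - \<infinity>"
      by (intro tendsto_uminus_ereal) (simp add: id_nat_ereal_tendsto_PInf)
    then show "(\<lambda>k. ereal (- real k)) \<longlonglongrightarrow> - \<infinity>" by simp
  qed
  show "(\<lambda>k. weight_coords n \<omega> (x k)) \<longlonglongrightarrow> d"
  proof (rule tendsto_coordinatewise)
    fix i
    show "(\<lambda>k. weight_coords n \<omega> (x k) i) \<longlonglongrightarrow> d i"
    proof (cases "i \<in> {1..n}")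
      case True
      have "weight_coords n \<omega> (x k) i = max (d i) (ereal (- real k))" for k
      proof -
        have "\<bar>max (d i) (ereal (- real k))\<bar> \<noteq> \<infinity>"
          using ext_space_less[OF d True] by (cases "d i") (auto simp: max_def)
        then show ?thesis
          using True by (simp add: weight_coords_def x_def weight_sum[OF True, simplified] ereal_real)
      qed
      with lim[of i] show ?thesis by simp
    next
      case False
      then have "d i = undefined" using d by (auto simp: ext_space_def)
      with False show ?thesis by (auto simp: weight_coords_def)
    qed
  qed
qed

lemma retr_ext_eqI:
  assumes mem: "R \<in> ext_space l n \<rightarrow>\<^sub>E K" and cont: "continuous_on (ext_space l n) R"
    and agree: "\<And>x. R (weight_coords n \<omega> x) = retr l \<alpha> x"
  shows "retr_ext l \<alpha> n \<omega> = R"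
  unfolding retr_ext_def
proof (rule the_equality)
  show "R \<in> ext_space l n \<rightarrow>\<^sub>E K \<and> continuous_on (ext_space l n) R \<and>
      (\<forall>x. R (weight_coords n \<omega> x) = retr l \<alpha> x)"
    using assms by blast
next
  fix r assume r: "r \<in> ext_space l n \<rightarrow>\<^sub>E K \<and> continuous_on (ext_space l n) r \<and>
      (\<forall>x. r (weight_coords n \<omega> x) = retr l \<alpha> x)"
  have "r d = R d" if d: "d \<in> ext_space l n" for d
  proof -
    obtain x where x: "(\<lambda>k. weight_coords n \<omega> (x k)) \<longlonglongrightarrow> d"
      using weight_coords_dense[OF d] by blast
    have "(\<lambda>k. f (weight_coords n \<omega> (x k))) \<longlonglongrightarrow> f d"
      if "continuous_on (ext_space l n) f" for f :: "_ \<Rightarrow> 'a"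
      using that x d by (rule continuous_on_tendsto_compose) (simp add: weight_coords_mem)
    from this[of r] this[OF cont] r agree show ?thesis
      using LIMSEQ_unique by auto
  qed
  then show "r = R"
    using r mem by (intro PiE_ext[of r _ _ R]) auto
qed

text \<open>The extension is \<open>r\<close> composed with a continuous map \<open>clip\<close> that raises the first \<open>l\<close> coordinates
  to the lower bound \<open>lo\<close> of \<open>central_lower_bound\<close>, and so makes them finite.  Clipping does not
  change which dominant points lie above, hence does not change \<open>r\<close>.\<close>

proposition retr_ext_le_iff:
  assumes d: "d \<in> ext_space l n" and y: "y \<in> K"
  shows "le (retr_ext l \<alpha> n \<omega> d) y \<longleftrightarrow>
    (\<forall>i\<in>{1..l}. d i \<le> ereal (\<omega> i y)) \<and> (\<forall>i\<in>{l+1..n}. d i = ereal (\<omega> i y))"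
proof -
  define E where "E = ext_space l n"
  obtain b where b: "\<And>i y. i \<in> {1..l} \<Longrightarrow> y \<in> K \<Longrightarrow> (\<Sum>j=l+1..n. b i j * \<omega> j y) \<le> \<omega> i y"
    using that by (rule central_lower_bound)
  define lo where "lo d i = (\<Sum>j=l+1..n. b i j * real_of_ereal (d j))" for d :: "nat \<Rightarrow> ereal" and i
  define c where "c d i = (if i \<le> l then max (d i) (ereal (lo d i)) else d i)" for d i
  define clip where "clip d = (\<Sum>i=1..n. real_of_ereal (c d i) *\<^sub>R e i)" for d
  have c_fin: "\<bar>c d i\<bar> \<noteq> \<infinity>" if "d \<in> E" "i \<in> {1..n}" for d i
    using ext_space_less[of d i] ext_space_finite[of d i] that
    by (cases "i \<le> l"; cases "d i") (auto simp: c_def E_def max_def)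
  have weight_clip: "ereal (\<omega> i (clip d)) = c d i" if "d \<in> E" "i \<in> {1..n}" for d i
    unfolding clip_def weight_sum[OF that(2)] using c_fin[OF that] by (simp add: ereal_real)
  have clip_le: "le (clip d) y \<longleftrightarrow>
      (\<forall>i\<in>{1..l}. d i \<le> ereal (\<omega> i y)) \<and> (\<forall>i\<in>{l+1..n}. d i = ereal (\<omega> i y))" (is "_ \<longleftrightarrow> ?R d y")
    if d: "d \<in> E" and y: "y \<in> K" for d y
  proof -
    have 1: "\<omega> i (clip d) = \<omega> i y \<longleftrightarrow> d i = ereal (\<omega> i y)" if "i \<in> {l+1..n}" for i
      using weight_clip[OF d, of i] that by (auto simp: c_def)
    have 2: "\<omega> i (clip d) \<le> \<omega> i y \<longleftrightarrow> d i \<le> ereal (\<omega> i y)"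
      if i: "i \<in> {1..l}" and cent: "\<forall>i\<in>{l+1..n}. d i = ereal (\<omega> i y)" for i
    proof -
      have "lo d i = (\<Sum>j=l+1..n. b i j * \<omega> j y)"
        unfolding lo_def using cent by (intro sum.cong) auto
      then have "lo d i \<le> \<omega> i y" using b[OF i y] by simp
      moreover have "ereal (\<omega> i (clip d)) = max (d i) (ereal (lo d i))"
        using weight_clip[OF d, of i] i l_le_n by (simp add: c_def)
      ultimately show ?thesis
        by (metis ereal_less_eq(3) max.bounded_iff)
    qed
    show ?thesis unfolding le_iff_weights using 1 2 by auto
  qed
  have coord: "continuous_on E (\<lambda>d. d i)" for i :: nat
    by (rule continuous_on_subset[OF continuous_on_product_coordinates]) simp
  have "continuous_on E (\<lambda>d. real_of_ereal (c d i))" if i: "i \<in> {1..n}" for i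
  proof (rule continuous_on_real_of_ereal_compose)
    have "continuous_on E (\<lambda>d. real_of_ereal (d j))" if "j \<in> {l+1..n}" for j
      using coord ext_space_finite[of _ j] that unfolding E_def
      by (intro continuous_on_real_of_ereal_compose) auto
    then have "continuous_on E (\<lambda>d. lo d i)"
      unfolding lo_def by (intro continuous_intros) auto
    then show "continuous_on E (\<lambda>d. c d i)"
      unfolding c_def using coord by (cases "i \<le> l") (auto intro!: continuous_intros)
  qed (use c_fin i in auto)
  then have cont_clip: "continuous_on E clip"
    unfolding clip_def by (intro continuous_intros) auto
  have "retr_ext l \<alpha> n \<omega> = restrict (\<lambda>d. retr l \<alpha> (clip d)) E"
  proof (rule retr_ext_eqI)
    show "restrict (\<lambda>d. retr l \<alpha> (clip d)) E \<in> ext_space l n \<rightarrow>\<^sub>E K"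
      by (auto simp: E_def retr_in_dom)
    have "continuous_on UNIV (retr l \<alpha>)"
      unfolding retr_def
      using convex_dom closed_dom dom_nonempty by (rule continuous_on_closest_point)
    then have "continuous_on E (\<lambda>d. retr l \<alpha> (clip d))"
      using cont_clip by (rule continuous_on_compose2) simp
    then show "continuous_on (ext_space l n) (restrict (\<lambda>d. retr l \<alpha> (clip d)) E)"
      unfolding E_def[symmetric] by (simp cong: continuous_on_cong)
  next
    fix x
    have wE: "weight_coords n \<omega> x \<in> E" unfolding E_def by (rule weight_coords_mem)
    have "retr l \<alpha> (clip (weight_coords n \<omega> x)) = retr l \<alpha> x"
    proof (rule retr_eqI)
      fix y assume y: "y \<in> K"
      show "le (clip (weight_coords n \<omega> x)) y \<longleftrightarrow> le x y"
        unfolding clip_le[OF wE y] unfolding le_iff_weights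
        using l_le_n by (auto simp: weight_coords_def)
    qed
    then show "restrict (\<lambda>d. retr l \<alpha> (clip d)) E (weight_coords n \<omega> x) = retr l \<alpha> x"
      using wE by simp
  qed
  then have "le (retr_ext l \<alpha> n \<omega> d) y \<longleftrightarrow> le (clip d) y"
    using retr_le_iff[OF y] d by (simp add: E_def)
  also have "\<dots> \<longleftrightarrow> ?R d y"
    using d y by (intro clip_le) (simp_all add: E_def)
  finally show ?thesis .
qed
end

section \<open>The valuation\<close>

locale dvr_on =
  fixes \<O> :: "'f::field set" and \<pi> :: 'f
  assumes dvr: "dvr \<O> \<pi>" and fraction_field: "fraction_field_of \<O>"
begin

abbreviation R where "R \<equiv> ring_on \<O>"

lemma ring_on_simps [simp]:
  "carrier R = \<O>" "mult R = (*)" "one R = 1" "zero R = 0" "add R = (+)"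
  by (simp_all add: ring_on_def)

sublocale R: principal_domain R
  using dvr by (simp add: dvr_def)

lemma one_mem: "1 \<in> \<O>" and zero_mem: "0 \<in> \<O>"
  and mult_mem: "a \<in> \<O> \<Longrightarrow> b \<in> \<O> \<Longrightarrow> a * b \<in> \<O>"
  using R.one_closed R.zero_closed R.m_closed[of a b] by simp_all

lemma unif: "\<pi> \<in> \<O>" "\<pi> \<noteq> 0" and primeideal_unif: "primeideal (PIdl\<^bsub>R\<^esub> \<pi>) R"
  and primeideal_unique: "primeideal I R \<Longrightarrow> I \<noteq> {0} \<Longrightarrow> I = PIdl\<^bsub>R\<^esub> \<pi>"
  using dvr by (auto simp: dvr_def)

lemma power_mem: "a \<in> \<O> \<Longrightarrow> a ^ k \<in> \<O>"
  by (induction k) (auto simp: one_mem mult_mem)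

lemma units_iff: "u \<in> units_on \<O> \<longleftrightarrow> u \<in> \<O> \<and> u \<noteq> 0 \<and> inverse u \<in> \<O>"
proof
  assume "u \<in> units_on \<O>"
  then obtain v where v: "u \<in> \<O>" "v \<in> \<O>" "v * u = 1"
    by (auto simp: units_on_def Units_def)
  then have "u \<noteq> 0" by auto
  with v have "v = inverse u" by (simp add: field_simps)
  with v \<open>u \<noteq> 0\<close> show "u \<in> \<O> \<and> u \<noteq> 0 \<and> inverse u \<in> \<O>" by simp
qed (auto simp: units_on_def Units_def intro!: bexI[of _ "inverse u"])

lemma units_mult: "u \<in> units_on \<O> \<Longrightarrow> v \<in> units_on \<O> \<Longrightarrow> u * v \<in> units_on \<O>"
  and units_inverse: "u \<in> units_on \<O> \<Longrightarrow> inverse u \<in> units_on \<O>"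
  and units_one: "1 \<in> units_on \<O>"
  by (auto simp: units_iff mult_mem one_mem)

lemma unif_not_unit: "inverse \<pi> \<notin> \<O>"
proof
  assume "inverse \<pi> \<in> \<O>"
  then have "\<pi> \<in> Units R"
    using unif units_iff[of \<pi>] by (simp add: units_on_def)
  then have "PIdl\<^bsub>R\<^esub> \<pi> = carrier R"
    using R.ideal_eq_carrier_iff[of \<pi>] unif by simp
  then show False
    using primeideal.I_notcarr[OF primeideal_unif] by simp
qed

lemma irreducible_associated_unif:
  assumes f: "f \<in> \<O>" "f \<noteq> 0" and irr: "irreducible (mult_of R) f"
  obtains u where "u \<in> units_on \<O>" "f = u * \<pi>"
proof -
  have "irreducible R f"
    using R.irreducible_mult_imp_irreducible[of f] f irr by simp
  then have "ring_irreducible\<^bsub>R\<^esub> f"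
    using f by (simp add: ring_irreducible_def)
  then have "maximalideal (PIdl\<^bsub>R\<^esub> f) R"
    using R.irreducible_imp_maximalideal f by simp
  then have "primeideal (PIdl\<^bsub>R\<^esub> f) R"
    by (rule R.maximalideal_prime)
  moreover have "f \<in> PIdl\<^bsub>R\<^esub> f"
    using R.cgenideal_self[of f] f by simp
  ultimately have "PIdl\<^bsub>R\<^esub> f = PIdl\<^bsub>R\<^esub> \<pi>"
    using f by (intro primeideal_unique) auto
  then have "f \<sim>\<^bsub>R\<^esub> \<pi>"
    using R.associated_iff_same_ideal[of f \<pi>] f unif by simp
  then show ?thesis
    using R.ring_associated_iff[of f \<pi>] f unif that by (auto simp: units_on_def)
qed

text \<open>A principal ideal domain has factorizations into irreducibles, each of which generates a nonzero
  prime ideal; since \<open>\<pi>\<close> generates the only such ideal, the irreducibles are associated to \<open>\<pi>\<close>.\<close>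

lemma integral_factorization:
  assumes "x \<in> \<O>" "x \<noteq> 0"
  obtains u k where "u \<in> units_on \<O>" "x = u * \<pi> ^ k"
proof -
  obtain fs where fs: "set fs \<subseteq> \<O> - {0}" "wfactors (mult_of R) fs x"
    using R.mult_of.wfactors_exist[of x] assms by auto
  have *: "\<exists>u\<in>units_on \<O>. \<exists>k. foldr (*) fs 1 = u * \<pi> ^ k"
    using fs(1) fs(2)[unfolded wfactors_def, THEN conjunct1]
  proof (induction fs)
    case Nil
    then show ?case using units_one by (auto intro!: bexI[of _ 1] exI[of _ 0])
  next
    case (Cons f fs)
    then obtain u k where uk: "u \<in> units_on \<O>" "foldr (*) fs 1 = u * \<pi> ^ k" by auto
    obtain v where v: "v \<in> units_on \<O>" "f = v * \<pi>"
      using irreducible_associated_unif[of f] Cons.prems by auto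
    have "foldr (*) (f # fs) 1 = (v * u) * \<pi> ^ Suc k"
      using uk v by simp
    then show ?case using units_mult[OF v(1) uk(1)] by blast
  qed
  then obtain u k where uk: "u \<in> units_on \<O>" "foldr (*) fs 1 = u * \<pi> ^ k" by blast
  have y: "u * \<pi> ^ k \<in> \<O>" "u * \<pi> ^ k \<noteq> 0"
    using uk(1) unif by (simp_all add: units_iff mult_mem power_mem)
  have "u * \<pi> ^ k \<sim>\<^bsub>mult_of R\<^esub> x"
    using fs(2) uk(2) by (simp add: wfactors_def)
  then have "u * \<pi> ^ k \<sim>\<^bsub>R\<^esub> x"
    using R.assoc_iff_assoc_mult[of "u * \<pi> ^ k" x] y assms by simp
  then have "x \<sim>\<^bsub>R\<^esub> u * \<pi> ^ k"
    unfolding associated_def by blast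
  then have "\<exists>v\<in>units_on \<O>. x = v * (u * \<pi> ^ k)"
    using R.ring_associated_iff[of x "u * \<pi> ^ k"] y(1) assms(1) by (simp add: units_on_def)
  then obtain v where v: "v \<in> units_on \<O>" "x = v * (u * \<pi> ^ k)" by blast
  show ?thesis
    by (rule that[of "v * u" k]) (use v units_mult[OF v(1) uk(1)] in \<open>simp_all add: mult.assoc\<close>)
qed

lemma factorization:
  assumes "x \<noteq> 0"
  obtains u m where "u \<in> units_on \<O>" "x = u * \<pi> powi m"
proof -
  obtain a b where ab: "a \<in> \<O>" "b \<in> \<O>" "b \<noteq> 0" "x = a / b"
    using fraction_field unfolding fraction_field_of_def by metis
  obtain u k where u: "u \<in> units_on \<O>" "a = u * \<pi> ^ k"
    using integral_factorization[of a] ab assms by auto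
  obtain v j where v: "v \<in> units_on \<O>" "b = v * \<pi> ^ j"
    using integral_factorization[of b] ab by auto
  have "x = (u * inverse v) * \<pi> powi (int k - int j)"
    using ab u v unif by (simp add: power_int_diff field_simps)
  then show ?thesis
    using that units_mult[OF u(1) units_inverse[OF v(1)]] by blast
qed

lemma exponent_nonneg:
  assumes "u \<in> units_on \<O>" "u * \<pi> powi m \<in> \<O>"
  shows "0 \<le> m"
proof (rule ccontr)
  assume "\<not> 0 \<le> m"
  define j where "j = nat (- m - 1)"
  have j: "m + int j = - 1"
    using \<open>\<not> 0 \<le> m\<close> by (simp add: j_def)
  have "inverse \<pi> = \<pi> powi (m + int j)"
    unfolding j by (simp add: power_int_minus)
  also have "\<dots> = \<pi> powi m * \<pi> ^ j"
    by (subst power_int_add) (simp_all add: unif(2))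
  also have "\<dots> = (u * \<pi> powi m) * (inverse u * \<pi> ^ j)"
    using assms(1) by (simp add: units_iff)
  also have "\<dots> \<in> \<O>"
    using assms(1) by (intro mult_mem[OF assms(2)] mult_mem power_mem unif) (simp add: units_iff)
  finally show False using unif_not_unit by simp
qed

lemma mem_iff_exponent:
  assumes "u \<in> units_on \<O>"
  shows "u * \<pi> powi m \<in> \<O> \<longleftrightarrow> 0 \<le> m"
proof
  assume "0 \<le> m"
  then have "\<pi> powi m = \<pi> ^ nat m" by (simp add: power_int_def)
  then show "u * \<pi> powi m \<in> \<O>"
    using assms unif by (simp add: units_iff mult_mem power_mem)
qed (rule exponent_nonneg[OF assms])

lemma exponent_unique:
  assumes "u \<in> units_on \<O>" "v \<in> units_on \<O>" "u * \<pi> powi m = v * \<pi> powi k"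
  shows "m = k"
proof -
  have *: "m \<le> k" if "u \<in> units_on \<O>" "v \<in> units_on \<O>" "u * \<pi> powi m = v * \<pi> powi k" for u v m k
  proof -
    have "(inverse u * v) * \<pi> powi (k - m) = 1"
      using that unif by (simp add: units_iff power_int_diff field_simps)
    then show ?thesis
      using exponent_nonneg[of "inverse u * v" "k - m"] that
      by (simp add: units_mult units_inverse one_mem)
  qed
  from *[OF assms] *[OF assms(2,1) assms(3)[symmetric]] show ?thesis by simp
qed

lemma val_zero: "val \<O> \<pi> 0 = -\<infinity>"
  by (simp add: val_def)

lemma val_unit_power:
  assumes "u \<in> units_on \<O>"
  shows "val \<O> \<pi> (u * \<pi> powi m) = ereal (real_of_int (- m))"
proof -
  have "(THE k. \<exists>v\<in>units_on \<O>. u * \<pi> powi m = v * \<pi> powi k) = m"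
    using assms exponent_unique by (intro the_equality) blast+
  moreover have "u * \<pi> powi m \<noteq> 0"
    using assms unif by (simp add: units_iff)
  ultimately show ?thesis by (simp add: val_def)
qed

lemma val_finite: "x \<noteq> 0 \<Longrightarrow> \<bar>val \<O> \<pi> x\<bar> \<noteq> \<infinity>"
  and val_less: "val \<O> \<pi> x < \<infinity>"
  by (simp_all add: val_def)

lemma val_eq_iff:
  "val \<O> \<pi> x = ereal (real_of_int k) \<longleftrightarrow> (\<exists>u\<in>units_on \<O>. x = u * \<pi> powi (- k))"
proof (cases "x = 0")
  case True
  then show ?thesis using unif by (auto simp: val_zero units_iff)
next
  case False
  then obtain u m where u: "u \<in> units_on \<O>" and x: "x = u * \<pi> powi m" by (rule factorization)
  have "val \<O> \<pi> x = ereal (real_of_int k) \<longleftrightarrow> m = - k"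
    unfolding x val_unit_power[OF u] by auto
  also have "\<dots> \<longleftrightarrow> (\<exists>u\<in>units_on \<O>. x = u * \<pi> powi (- k))"
  proof
    assume "m = - k"
    with u x show "\<exists>u\<in>units_on \<O>. x = u * \<pi> powi (- k)" by blast
  next
    assume "\<exists>u\<in>units_on \<O>. x = u * \<pi> powi (- k)"
    then obtain v where "v \<in> units_on \<O>" "x = v * \<pi> powi (- k)" by blast
    with u x show "m = - k" by (intro exponent_unique[of u v]) simp_all
  qed
  finally show ?thesis .
qed

lemma frac_ideal_iff_val: "x \<in> frac_ideal \<O> \<pi> j \<longleftrightarrow> val \<O> \<pi> x \<le> ereal (real_of_int (- j))"
proof (cases "x = 0")
  case True
  then show ?thesis using zero_mem by (auto simp: val_zero frac_ideal_def)
next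
  case False
  then obtain u m where u: "u \<in> units_on \<O>" and x: "x = u * \<pi> powi m" by (rule factorization)
  have "x \<in> frac_ideal \<O> \<pi> j \<longleftrightarrow> u * \<pi> powi (m - j) \<in> \<O>"
  proof
    assume "x \<in> frac_ideal \<O> \<pi> j"
    then obtain a where "a \<in> \<O>" "x = \<pi> powi j * a" by (auto simp: frac_ideal_def)
    then show "u * \<pi> powi (m - j) \<in> \<O>"
      using x unif by (simp add: power_int_diff field_simps)
  next
    assume "u * \<pi> powi (m - j) \<in> \<O>"
    moreover have "x = \<pi> powi j * (u * \<pi> powi (m - j))"
      using x unif by (simp add: power_int_diff field_simps)
    ultimately show "x \<in> frac_ideal \<O> \<pi> j" unfolding frac_ideal_def by blast
  qed
  also have "\<dots> \<longleftrightarrow> j \<le> m" using mem_iff_exponent[OF u] by simp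
  also have "\<dots> \<longleftrightarrow> val \<O> \<pi> x \<le> ereal (real_of_int (- j))"
    using u x by (simp add: val_unit_power)
  finally show ?thesis .
qed

end

section \<open>The chamber of a root datum\<close>

locale weighted_root_datum = root_datum L \<Phi> cor
  for L :: "'a::{real_inner,heine_borel} set" and \<Phi> :: "'a dual set" and cor :: "'a dual \<Rightarrow> 'a" +
  fixes l n :: nat and \<alpha> \<omega> :: "nat \<Rightarrow> 'a dual"
  assumes invariant_inner: "weyl_invariant_inner \<Phi> cor"
    and simple: "simple_roots \<Phi> l \<alpha>"
    and n_dim: "n = dim (UNIV :: 'a set)"
    and weights: "extend_fundamental_weights L cor l \<alpha> \<omega>"
    and central_basis: "basis_central_chars L cor l \<alpha> n \<omega>"
begin

abbreviation co where "co i \<equiv> cor (\<alpha> i)"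

lemma simple_root: "i \<in> {1..l} \<Longrightarrow> \<alpha> i \<in> \<Phi>"
  using simple by (auto simp: simple_roots_def)

lemma coroot_mem: "\<beta> \<in> \<Phi> \<Longrightarrow> cor \<beta> \<in> L"
  using coroots_in_lattice by blast

lemma coroot_norm_pos: "\<beta> \<in> \<Phi> \<Longrightarrow> 0 < cor \<beta> \<bullet> cor \<beta>"
  using root_coroot[of \<beta>] by (cases "cor \<beta> = 0") (auto simp: blinfun.zero_right)

text \<open>Invariance under the reflection in \<open>\<beta>\<close>, which negates \<open>cor \<beta>\<close>, makes \<open>\<beta>\<close> proportional to the inner
  product with its coroot.  Orthogonality to coroots thus replaces vanishing of roots, and relations
  between roots become relations between coroots.\<close>

lemma root_eq_inner:
  assumes \<beta>: "\<beta> \<in> \<Phi>"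
  shows "\<beta> x = 2 / (cor \<beta> \<bullet> cor \<beta>) * (x \<bullet> cor \<beta>)"
proof -
  have "coroot_refl cor \<beta> (cor \<beta>) = - cor \<beta>"
    by (simp add: coroot_refl_def root_coroot[OF \<beta>] scaleR_2)
  moreover have "coroot_refl cor \<beta> x \<bullet> coroot_refl cor \<beta> (cor \<beta>) = x \<bullet> cor \<beta>"
    using invariant_inner \<beta> by (simp add: weyl_invariant_inner_def)
  ultimately have "\<beta> x * (cor \<beta> \<bullet> cor \<beta>) = 2 * (x \<bullet> cor \<beta>)"
    by (simp add: coroot_refl_def inner_diff_left)
  then show ?thesis using coroot_norm_pos[OF \<beta>] by (simp add: field_simps)
qed

lemma root_expansion:
  assumes "\<beta> \<in> \<Phi>"
  shows "\<exists>c. \<beta> = (\<Sum>i=1..l. c i *\<^sub>R \<alpha> i) \<and> ((\<forall>i. 0 \<le> c i) \<or> (\<forall>i. c i \<le> 0))"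
proof -
  have "\<exists>k::nat \<Rightarrow> nat. \<beta> = (\<Sum>i=1..l. real (k i) *\<^sub>R \<alpha> i) \<or> \<beta> = - (\<Sum>i=1..l. real (k i) *\<^sub>R \<alpha> i)"
    using simple assms by (simp add: simple_roots_def)
  then obtain k :: "nat \<Rightarrow> nat" where
    "\<beta> = (\<Sum>i=1..l. real (k i) *\<^sub>R \<alpha> i) \<or> \<beta> = - (\<Sum>i=1..l. real (k i) *\<^sub>R \<alpha> i)" ..
  then show ?thesis
  proof
    assume "\<beta> = (\<Sum>i=1..l. real (k i) *\<^sub>R \<alpha> i)"
    then show ?thesis by (intro exI[of _ "\<lambda>i. real (k i)"]) simp
  next
    assume "\<beta> = - (\<Sum>i=1..l. real (k i) *\<^sub>R \<alpha> i)"
    then show ?thesis by (intro exI[of _ "\<lambda>i. - real (k i)"]) (simp add: sum_negf)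
  qed
qed

text \<open>Reflecting \<open>\<alpha> j\<close> in \<open>\<alpha> i\<close> gives a root with coefficient \<open>1\<close> at \<open>\<alpha> j\<close>.  The coefficients of a root
  are all non-negative or all non-positive, so the coefficient at \<open>\<alpha> i\<close>, which is \<open>- \<alpha> j (co i)\<close>, is non-negative.\<close>

lemma simple_coroots_obtuse:
  assumes ij: "i \<in> {1..l}" "j \<in> {1..l}" "i \<noteq> j"
  shows "co i \<bullet> co j \<le> 0"
proof -
  define m where "m = \<alpha> j (co i)"
  have inj: "inj_on \<alpha> {1..l}" and ind: "independent (\<alpha> ` {1..l})"
    using simple by (auto simp: simple_roots_def)
  have coeff: "c h = d h"
    if eq: "(\<Sum>h=1..l. c h *\<^sub>R \<alpha> h) = (\<Sum>h=1..l. d h *\<^sub>R \<alpha> h)" and h: "h \<in> {1..l}"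
    for c d :: "nat \<Rightarrow> real" and h
  proof -
    have "(\<Sum>h=1..l. (c h - d h) *\<^sub>R \<alpha> h) = 0"
      using eq by (simp add: scaleR_left_diff_distrib sum_subtractf)
    then have "c h - d h = 0"
      by (intro independent_family_coefficients[OF _ inj ind _ h]) simp_all
    then show ?thesis by simp
  qed
  define c where "c h = (if h = j then 1 else 0) - (if h = i then m else 0)" for h
  have "\<alpha> j - m *\<^sub>R \<alpha> i = (\<Sum>h=1..l. if h = j then \<alpha> j else 0) - (\<Sum>h=1..l. if h = i then m *\<^sub>R \<alpha> i else 0)"
    using ij by simp
  also have "\<dots> = (\<Sum>h=1..l. c h *\<^sub>R \<alpha> h)"
    unfolding sum_subtractf[symmetric] by (intro sum.cong) (auto simp: c_def algebra_simps)
  finally have refl: "root_refl cor (\<alpha> i) (\<alpha> j) = (\<Sum>h=1..l. c h *\<^sub>R \<alpha> h)"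
    by (simp add: root_refl_def m_def)
  moreover have "root_refl cor (\<alpha> i) (\<alpha> j) \<in> \<Phi>"
    using ij simple_root by (intro refl_root)
  ultimately obtain d where
    d: "(\<Sum>h=1..l. c h *\<^sub>R \<alpha> h) = (\<Sum>h=1..l. d h *\<^sub>R \<alpha> h)" "(\<forall>h. 0 \<le> d h) \<or> (\<forall>h. d h \<le> 0)"
    by (metis root_expansion)
  have "d i = - m" "d j = 1"
    using coeff[OF d(1) ij(1)] coeff[OF d(1) ij(2)] ij(3) by (simp_all add: c_def)
  then have "m \<le> 0"
    using d(2) by (metis neg_0_le_iff_le not_one_le_zero)
  then show ?thesis
    using root_eq_inner[OF simple_root[OF ij(2)], of "co i"] coroot_norm_pos[OF simple_root[OF ij(2)]]
    by (simp add: m_def mult_le_0_iff divide_le_0_iff zero_le_mult_iff)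
qed

lemma weight_char: "i \<in> {1..l} \<Longrightarrow> \<omega> i \<in> char_lattice L"
  and weight_coroot: "i \<in> {1..l} \<Longrightarrow> j \<in> {1..l} \<Longrightarrow> \<omega> i (co j) = (if i = j then 1 else 0)"
  using weights by (auto simp: extend_fundamental_weights_def)

lemma central_weight: "i \<in> {l+1..n} \<Longrightarrow> \<omega> i \<in> central_chars L cor l \<alpha>"
  using central_basis int_mod.span_base[of "\<omega> i" "\<omega> ` {l+1..n}"]
  by (simp add: basis_central_chars_def)

lemma rank_le: "l \<le> n"
proof -
  obtain B where B: "finite B" "independent B" "span B = (UNIV :: 'a set)"
    using lattice by blast
  have ind: "independent (co ` {1..l})"
  proof (rule ccontr)
    assume "\<not> independent (co ` {1..l})"
    then obtain i where i: "i \<in> {1..l}" "co i \<in> span (co ` {1..l} - {co i})"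
      unfolding dependent_def by blast
    have "\<omega> i v = 0" if "v \<in> span (co ` {1..l} - {co i})" for v
      using that i(1)
      by (induction rule: span_induct_alt) (auto simp: blinfun.add_right blinfun.scaleR_right weight_coroot split: if_splits)
    from this[OF i(2)] show False using i(1) weight_coroot[of i i] by simp
  qed
  have inj: "inj_on co {1..l}"
  proof (rule inj_onI)
    fix i j assume "i \<in> {1..l}" "j \<in> {1..l}" "co i = co j"
    then show "i = j" using weight_coroot[of i i] weight_coroot[of i j] by (auto split: if_splits)
  qed
  have "card (co ` {1..l}) \<le> card B"
    using independent_span_bound[OF B(1) ind] B(3) by simp
  moreover have "card B = n"
    using B n_dim dim_eq_card_independent[OF B(2)] by (metis dim_span)
  ultimately show ?thesis using inj by (simp add: card_image)
qed

text \<open>Removing the integral combination \<open>\<Sum>i. \<xi> (co i) \<omega> i\<close> from a character \<open>\<xi>\<close> leaves a character that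
  vanishes on all simple coroots, hence an integral combination of the basis of \<open>X\<^sup>*(D)\<close>.\<close>

lemma char_in_span:
  assumes \<xi>: "\<xi> \<in> char_lattice L"
  shows "\<xi> \<in> span (\<omega> ` {1..n})"
proof -
  define \<zeta> where "\<zeta> = \<xi> - (\<Sum>i=1..l. \<xi> (co i) *\<^sub>R \<omega> i)"
  have "\<zeta> x \<in> \<int>" if "x \<in> L" for x
    unfolding \<zeta>_def blinfun.diff_left blinfun.sum_left blinfun.scaleR_left
    using \<xi> that weight_char coroot_mem simple_root
    by (intro Ints_diff Ints_sum Ints_mult) (auto simp: char_lattice_def)
  moreover have "\<zeta> (co j) = 0" if "j \<in> {1..l}" for j
  proof -
    have "(\<Sum>i=1..l. \<xi> (co i) *\<^sub>R \<omega> i) (co j) = (\<Sum>i=1..l. if i = j then \<xi> (co j) else 0)"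
      unfolding blinfun.sum_left blinfun.scaleR_left
      using that by (intro sum.cong) (auto simp: weight_coroot)
    then show ?thesis using that by (simp add: \<zeta>_def blinfun.diff_left)
  qed
  ultimately have "\<zeta> \<in> central_chars L cor l \<alpha>"
    by (simp add: central_chars_def char_lattice_def)
  then have "\<zeta> \<in> int_mod.span (\<omega> ` {l+1..n})"
    using central_basis by (simp add: basis_central_chars_def)
  then have \<zeta>: "\<zeta> \<in> span (\<omega> ` {1..n})"
  proof (induction rule: int_mod.span_induct_alt)
    case base
    show ?case by (rule span_zero)
  next
    case (step c x y)
    then show ?case by (intro span_add[OF span_scale[OF span_base]]) auto
  qed
  have "\<xi> = \<zeta> + (\<Sum>i=1..l. \<xi> (co i) *\<^sub>R \<omega> i)" by (simp add: \<zeta>_def)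
  also have "\<dots> \<in> span (\<omega> ` {1..n})"
    using rank_le by (intro span_add span_sum span_scale \<zeta> span_base) auto
  finally show ?thesis .
qed

text \<open>The coordinate functionals of a lattice basis are characters, hence combinations of the \<open>\<omega> i\<close>;
  substituting these combinations into the expansion in the lattice basis and collecting the terms
  of each \<open>\<omega> i\<close> gives the vectors \<open>e i\<close>.\<close>

lemma weight_expansion:
  obtains e where "\<And>x. x = (\<Sum>i=1..n. \<omega> i x *\<^sub>R e i)"
proof -
  obtain B where B: "finite B" "independent B" "span B = (UNIV :: 'a set)" "L = int_mod.span B"
    using lattice by blast
  have "\<forall>b\<in>B. \<exists>m. \<forall>x u. x = (\<Sum>b\<in>B. u b *\<^sub>R b) \<longrightarrow> u b = (\<Sum>i=1..n. m i * \<omega> i x)"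
  proof
    fix b assume b: "b \<in> B"
    have "b \<notin> span (B - {b})" using B(2) b by (auto simp: dependent_def)
    then obtain w where w: "w \<bullet> b = 1" "\<And>y. y \<in> span (B - {b}) \<Longrightarrow> w \<bullet> y = 0"
      using separating_vector[of "B - {b}" b] B(1) by auto
    have wB: "w \<bullet> y = (if y = b then 1 else 0)" if "y \<in> B" for y
      using w that by (auto intro: span_base)
    have "w \<bullet> x \<in> \<int>" if "x \<in> L" for x
      using that unfolding B(4)
      by (induction rule: int_mod.span_induct_alt) (auto simp: inner_add_right wB)
    then have "blinfun_inner_left w \<in> char_lattice L"
      by (simp add: char_lattice_def inner_commute)
    then obtain m where m: "blinfun_inner_left w = (\<Sum>i\<in>{1..n}. m i *\<^sub>R \<omega> i)"
      using span_image_finiteE[of "{1..n}" _ \<omega>] char_in_span by (metis finite_atLeastAtMost)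
    have "u b = (\<Sum>i=1..n. m i * \<omega> i x)" if x: "x = (\<Sum>b\<in>B. u b *\<^sub>R b)" for x u
    proof -
      have "u b = (\<Sum>y\<in>B. if y = b then u b else 0)" using B(1) b by simp
      also have "\<dots> = w \<bullet> x"
        unfolding x inner_sum_right by (intro sum.cong) (auto simp: wB)
      also have "\<dots> = blinfun_inner_left w x" by (simp add: inner_commute)
      also have "\<dots> = (\<Sum>i=1..n. m i * \<omega> i x)"
        unfolding m by (simp add: blinfun.sum_left blinfun.scaleR_left)
      finally show ?thesis .
    qed
    then show "\<exists>m. \<forall>x u. x = (\<Sum>b\<in>B. u b *\<^sub>R b) \<longrightarrow> u b = (\<Sum>i=1..n. m i * \<omega> i x)"
      by blast
  qed
  from bchoice[OF this] obtain m where
    "\<forall>b\<in>B. \<forall>x u. x = (\<Sum>b\<in>B. u b *\<^sub>R b) \<longrightarrow> u b = (\<Sum>i=1..n. m b i * \<omega> i x)" ..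
  then have m: "u b = (\<Sum>i=1..n. m b i * \<omega> i x)" if "b \<in> B" "x = (\<Sum>b\<in>B. u b *\<^sub>R b)" for b x u
    using that by blast
  show ?thesis
  proof
    fix x
    obtain u where u: "x = (\<Sum>b\<in>B. u b *\<^sub>R b)"
      using span_image_finiteE[of B x "\<lambda>b. b"] B(1,3) by auto
    have "x = (\<Sum>b\<in>B. (\<Sum>i=1..n. m b i * \<omega> i x) *\<^sub>R b)"
      by (subst u) (intro sum.cong, use m[OF _ u] in auto)
    also have "\<dots> = (\<Sum>i=1..n. \<Sum>b\<in>B. (m b i * \<omega> i x) *\<^sub>R b)"
      unfolding scaleR_sum_left by (rule sum.swap)
    also have "\<dots> = (\<Sum>i=1..n. \<omega> i x *\<^sub>R (\<Sum>b\<in>B. m b i *\<^sub>R b))"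
      by (simp add: scaleR_sum_right mult.commute)
    finally show "x = (\<Sum>i=1..n. \<omega> i x *\<^sub>R (\<Sum>b\<in>B. m b i *\<^sub>R b))" .
  qed
qed

lemma exists_chamber: "\<exists>e. chamber l n \<alpha> \<omega> cor e"
proof -
  obtain e where e: "\<And>x. x = (\<Sum>i=1..n. \<omega> i x *\<^sub>R e i)"
    using that by (rule weight_expansion)
  have "chamber l n \<alpha> \<omega> cor e"
  proof
    show "l \<le> n" by (rule rank_le)
    show "\<exists>k>0. \<forall>x. \<alpha> i x = k * (x \<bullet> co i)" if "i \<in> {1..l}" for i
      using root_eq_inner[OF simple_root[OF that]] coroot_norm_pos[OF simple_root[OF that]]
      by (intro exI[of _ "2 / (co i \<bullet> co i)"]) auto
    show "co i \<bullet> co j \<le> 0" if "i \<in> {1..l}" "j \<in> {1..l}" "i \<noteq> j" for i j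
      using that by (rule simple_coroots_obtuse)
    show "x = (\<Sum>i=1..n. \<omega> i x *\<^sub>R e i)" for x by (rule e)
    show "\<omega> i (e j) = (if i = j then 1 else 0)" if "i \<in> {1..n}" "j \<in> {1..n}" for i j
      using e n_dim that by (rule dual_of_expansion)
    show "e i = co i" if i: "i \<in> {1..l}" for i
    proof -
      have "\<omega> j (co i) = (if j = i then 1 else 0)" if "j \<in> {1..n}" for j
        using that i central_weight[of j] weight_coroot[of j i]
        by (cases "j \<le> l") (auto simp: central_chars_def)
      then have "(\<Sum>j=1..n. \<omega> j (co i) *\<^sub>R e j) = (\<Sum>j=1..n. if j = i then e i else 0)"
        by (intro sum.cong) auto
      then show ?thesis
        using e[of "co i"] i rank_le by simp
    qed
  qed
  then show ?thesis by blast
qed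

text \<open>Under the inner product \<open>\<beta>\<close> becomes a multiple of \<open>cor \<beta>\<close>, so the expansion of \<open>\<beta>\<close> in simple roots
  becomes one of \<open>cor \<beta>\<close> in simple coroots.\<close>

lemma coroot_in_span:
  assumes \<beta>: "\<beta> \<in> \<Phi>"
  shows "cor \<beta> \<in> span (co ` {1..l})"
proof -
  obtain c where c: "\<beta> = (\<Sum>i=1..l. c i *\<^sub>R \<alpha> i)"
    using root_expansion[OF \<beta>] by metis
  define v where "v = (\<Sum>i=1..l. (c i * (2 / (co i \<bullet> co i))) *\<^sub>R co i)"
  have "x \<bullet> ((2 / (cor \<beta> \<bullet> cor \<beta>)) *\<^sub>R cor \<beta>) = x \<bullet> v" for x
  proof -
    have "x \<bullet> ((2 / (cor \<beta> \<bullet> cor \<beta>)) *\<^sub>R cor \<beta>) = \<beta> x"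
      by (simp add: root_eq_inner[OF \<beta>])
    also have "\<dots> = (\<Sum>i=1..l. c i * \<alpha> i x)"
      by (simp add: c blinfun.sum_left blinfun.scaleR_left)
    also have "\<dots> = (\<Sum>i=1..l. c i * (2 / (co i \<bullet> co i) * (x \<bullet> co i)))"
      by (intro sum.cong) (simp_all add: root_eq_inner[OF simple_root])
    also have "\<dots> = x \<bullet> v"
      by (simp add: v_def inner_sum_right mult.assoc)
    finally show ?thesis .
  qed
  then have "(2 / (cor \<beta> \<bullet> cor \<beta>)) *\<^sub>R cor \<beta> = v"
    by (metis vector_eq_rdot inner_commute)
  then have "cor \<beta> = ((cor \<beta> \<bullet> cor \<beta>) / 2) *\<^sub>R v"
    using coroot_norm_pos[OF \<beta>] by (auto simp: field_simps)
  moreover have "v \<in> span (co ` {1..l})"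
    unfolding v_def by (intro span_sum span_scale span_base) auto
  ultimately show ?thesis by (metis span_scale)
qed

lemma central_vanishes_on_span:
  assumes "\<xi> \<in> central_chars L cor l \<alpha>" "v \<in> span (co ` {1..l})"
  shows "\<xi> v = 0"
  using assms(2)
proof (induction rule: span_induct_alt)
  case (step c x y)
  then show ?case
    using assms(1) by (auto simp: central_chars_def blinfun.add_right blinfun.scaleR_right)
qed (simp add: blinfun.zero_right)

text \<open>The face space of a Levi subgroup is the orthogonal complement of the span of its coroots, so that
  \<open>levi_proj\<close> is an orthogonal projection and the description defining it is satisfied.\<close>

lemma levi_space_iff:
  assumes "J \<subseteq> {1..l}"
  shows "y \<in> levi_space \<alpha> J \<longleftrightarrow> (\<forall>v\<in>span (co ` J). y \<bullet> v = 0)"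
proof -
  have *: "\<alpha> j y = 0 \<longleftrightarrow> y \<bullet> co j = 0" if "j \<in> J" for j
    using root_eq_inner[OF simple_root, of j y] coroot_norm_pos[OF simple_root, of j] that assms
    by auto
  have "(\<forall>v\<in>span (co ` J). y \<bullet> v = 0) \<longleftrightarrow> (\<forall>j\<in>J. y \<bullet> co j = 0)"
  proof
    assume J: "\<forall>j\<in>J. y \<bullet> co j = 0"
    show "\<forall>v\<in>span (co ` J). y \<bullet> v = 0"
    proof
      fix v assume "v \<in> span (co ` J)"
      then show "y \<bullet> v = 0"
        using J by (induction rule: span_induct_alt) (auto simp: inner_add_right)
    qed
  qed (auto intro: span_base)
  with * show ?thesis by (auto simp: levi_space_def)
qed

lemma levi_proj_diff:
  assumes J: "J \<subseteq> {1..l}"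
  shows "x - levi_proj cor \<alpha> J x \<in> span (co ` J)"
proof -
  have "finite J" using J finite_subset by blast
  then obtain s where s: "s \<in> span (co ` J)" "\<And>y. y \<in> span (co ` J) \<Longrightarrow> (x - s) \<bullet> y = 0"
    using orthogonal_decomposition[of "co ` J" x] by blast
  have "levi_proj cor \<alpha> J x = x - s"
    unfolding levi_proj_def
  proof (rule the_equality)
    show "x - s \<in> levi_space \<alpha> J \<and> x - (x - s) \<in> span (co ` J)"
      using s by (simp add: levi_space_iff[OF J])
  next
    fix y assume y: "y \<in> levi_space \<alpha> J \<and> x - y \<in> span (co ` J)"
    then have d: "(x - s) - y \<in> span (co ` J)"
      using span_diff[OF _ s(1), of "x - y"] by (simp add: algebra_simps)
    have "((x - s) - y) \<bullet> ((x - s) - y) = 0"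
      using s(2)[OF d] y d by (simp add: levi_space_iff[OF J] inner_diff_left)
    then show "y = x - s" by simp
  qed
  then show ?thesis using s(1) by simp
qed

lemma newton_point_dom:
  assumes "\<mu> \<in> newton_points L cor l \<alpha>"
  shows "\<mu> \<in> dom_cone l \<alpha>"
proof -
  obtain J where J: "\<mu> \<in> open_face l \<alpha> J"
    using assms by (auto simp: newton_points_def)
  have "0 \<le> \<alpha> i \<mu>" if "i \<in> {1..l}" for i
    using J that by (cases "i \<in> J") (auto simp: open_face_def levi_space_def less_imp_le)
  then show ?thesis by (simp add: dom_cone_def)
qed

text \<open>A character of \<open>D\<close> does not see the Levi projection, so on \<open>\<mu>\<close> it takes the value that it has on a
  cocharacter projecting to \<open>\<mu>\<close>.\<close>

lemma newton_point_central_integral: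
  assumes "\<mu> \<in> newton_points L cor l \<alpha>" "\<xi> \<in> central_chars L cor l \<alpha>"
  shows "\<xi> \<mu> \<in> \<int>"
proof -
  obtain J x where J: "J \<subseteq> {1..l}" and x: "x \<in> L" and \<mu>: "\<mu> = levi_proj cor \<alpha> J x"
    using assms(1) by (auto simp: newton_points_def levi_lattice_def)
  have "x - \<mu> \<in> span (co ` {1..l})"
    using levi_proj_diff[OF J, of x] span_mono[of "co ` J" "co ` {1..l}"] J unfolding \<mu> by blast
  then have "\<xi> (x - \<mu>) = 0"
    by (rule central_vanishes_on_span[OF assms(2)])
  then have "\<xi> \<mu> = \<xi> x" by (simp add: blinfun.diff_right)
  then show ?thesis using assms(2) x by (auto simp: central_chars_def char_lattice_def)
qed

lemma weyl_central:
  assumes "\<xi> \<in> central_chars L cor l \<alpha>" "w \<in> weyl \<Phi> cor"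
  shows "w \<xi> = \<xi>"
  using assms(2)
proof induction
  case (weyl_refl w \<beta>)
  have "\<xi> (cor \<beta>) = 0"
    using assms(1) coroot_in_span[OF weyl_refl(2)] by (rule central_vanishes_on_span)
  with weyl_refl show ?case by (simp add: root_refl_def)
qed simp

lemma weyl_inj:
  assumes "w \<in> weyl \<Phi> cor"
  shows "inj w"
  using assms
proof induction
  case (weyl_refl w \<beta>)
  have "root_refl cor \<beta> (root_refl cor \<beta> \<xi>) = \<xi>" for \<xi>
    by (simp add: root_refl_def blinfun.diff_left blinfun.scaleR_left root_coroot[OF weyl_refl(2)]
        algebra_simps)
  then have "inj (root_refl cor \<beta>)" by (rule inj_on_inverseI)
  then show ?case using weyl_refl by (intro inj_compose)
qed simp

end

section \<open>The subsets of the adjoint quotient as boxes\<close>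

locale adjoint_quotient =
  dvr_on \<O> \<pi> + weighted_root_datum L \<Phi> cor l n \<alpha> \<omega>
  for \<O> :: "'f::field set" and \<pi> :: 'f
    and L :: "'a::{real_inner,heine_borel} set" and \<Phi> :: "'a dual set" and cor :: "'a dual \<Rightarrow> 'a"
    and l n :: nat and \<alpha> \<omega> :: "nat \<Rightarrow> 'a dual"
begin

lemma central_orbit_sum:
  assumes \<xi>: "\<xi> \<in> central_chars L cor l \<alpha>"
  shows "orbit_sum \<Phi> cor \<xi> = Poly_Mapping.single \<xi> (1::'f)"
proof -
  have "{w \<xi> |w. w \<in> weyl \<Phi> cor} = {\<xi>}"
    using weyl_central[OF \<xi>] weyl.weyl_id[of \<Phi> cor] by (auto intro: exI[of _ id])
  then show ?thesis by (simp add: orbit_sum_def)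
qed

lemma central_single_invariant:
  assumes \<xi>: "\<xi> \<in> central_chars L cor l \<alpha>"
  shows "Poly_Mapping.single \<xi> (1::'f) \<in> invariant_functions \<O> L \<Phi> cor"
proof -
  have *: "w \<eta> = \<xi> \<longleftrightarrow> \<eta> = \<xi>" if "w \<in> weyl \<Phi> cor" for w \<eta>
    using weyl_central[OF \<xi> that] weyl_inj[OF that] by (metis injD)
  have "Poly_Mapping.lookup (Poly_Mapping.single \<xi> (1::'f)) (w \<eta>)
      = Poly_Mapping.lookup (Poly_Mapping.single \<xi> 1) \<eta>" if "w \<in> weyl \<Phi> cor" for w \<eta>
    using *[OF that, of \<eta>] by (auto simp: lookup_single when_def)
  moreover have "\<xi> \<in> char_lattice L"
    using \<xi> by (simp add: central_chars_def)
  ultimately show ?thesis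
    using one_mem zero_mem
    by (auto simp: invariant_functions_def torus_functions_def lookup_single when_def)
qed

text \<open>A character \<open>\<xi>\<close> of \<open>D\<close> is fixed by the Weyl group, so \<open>e\<^sup>\<xi>\<close> and its inverse \<open>e\<^sup>-\<^sup>\<xi>\<close> are both
  regular functions on the quotient.\<close>

lemma central_coord_nonzero:
  assumes c: "c \<in> adj_points \<O> L \<Phi> cor" and i: "i \<in> {l+1..n}"
  shows "adj_coord \<Phi> cor \<omega> c i \<noteq> 0"
proof -
  define \<xi> where "\<xi> = \<omega> i"
  have \<xi>: "\<xi> \<in> central_chars L cor l \<alpha>"
    unfolding \<xi>_def using i by (rule central_weight)
  then have \<xi>': "- \<xi> \<in> central_chars L cor l \<alpha>"
    by (auto simp: central_chars_def char_lattice_def blinfun.minus_left)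
  have "c (Poly_Mapping.single \<xi> 1 * Poly_Mapping.single (- \<xi>) 1)
      = c (Poly_Mapping.single \<xi> 1) * c (Poly_Mapping.single (- \<xi>) 1)"
    using c central_single_invariant[OF \<xi>] central_single_invariant[OF \<xi>']
    by (auto simp: adj_points_def ring_hom_def ring_on_def)
  moreover have "c (Poly_Mapping.single 0 1) = 1"
    using c one_mem unfolding adj_points_def by blast
  then have "c (Poly_Mapping.single \<xi> 1 * Poly_Mapping.single (- \<xi>) 1) = 1"
    by (simp add: mult_single)
  ultimately show ?thesis
    by (auto simp: adj_coord_def \<xi>_def[symmetric] central_orbit_sum[OF \<xi>])
qed

lemma val_vector_mem:
  assumes c: "c \<in> adj_points \<O> L \<Phi> cor"
  shows "val_vector \<O> \<pi> \<Phi> cor n \<omega> c \<in> ext_space l n"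
proof -
  have "val \<O> \<pi> (adj_coord \<Phi> cor \<omega> c i) \<in> (if i \<le> l then {..<\<infinity>} else {-\<infinity><..<\<infinity>})"
    if "i \<in> {1..n}" for i
    using that val_less[of "adj_coord \<Phi> cor \<omega> c i"]
      val_finite[OF central_coord_nonzero[OF c, of i]] by auto
  then show ?thesis
    unfolding val_vector_def ext_space_def by (intro restrict_PiE_iff[THEN iffD2]) blast
qed

lemma mem_adj_le_iff:
  assumes c: "c \<in> adj_points \<O> L \<Phi> cor" and \<mu>: "\<mu> \<in> dom_cone l \<alpha>"
  shows "c \<in> adj_le \<O> \<pi> L \<Phi> cor l \<alpha> n \<omega> \<mu> \<longleftrightarrow>
    (\<forall>i\<in>{1..l}. val \<O> \<pi> (adj_coord \<Phi> cor \<omega> c i) \<le> ereal (\<omega> i \<mu>)) \<and>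
    (\<forall>i\<in>{l+1..n}. val \<O> \<pi> (adj_coord \<Phi> cor \<omega> c i) = ereal (\<omega> i \<mu>))"
proof -
  obtain e where "chamber l n \<alpha> \<omega> cor e"
    using exists_chamber by blast
  then interpret chamber l n \<alpha> \<omega> cor e .
  show ?thesis
    using c retr_ext_le_iff[OF val_vector_mem[OF c] \<mu>] l_le_n
    by (auto simp: adj_le_def val_vector_def)
qed

lemma val_le_floor: "val \<O> \<pi> x \<le> ereal r \<longleftrightarrow> val \<O> \<pi> x \<le> ereal (real_of_int \<lfloor>r\<rfloor>)"
proof (cases "x = 0")
  case False
  then obtain u m where "u \<in> units_on \<O>" "x = u * \<pi> powi m" by (rule factorization)
  then show ?thesis
    by (simp only: val_unit_power ereal_less_eq of_int_le_iff le_floor_iff)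
qed (simp add: val_zero)

definition central_coset :: "'a \<Rightarrow> (nat \<Rightarrow> 'f) set" where
  "central_coset \<mu> = (\<Pi>\<^sub>E i\<in>{l+1..n}. {u * \<pi> powi (- \<lfloor>\<omega> i \<mu>\<rfloor>) |u. u \<in> units_on \<O>})"

lemma unit_coset_central_coset: "unit_coset \<O> l n (central_coset \<mu>)"
  unfolding unit_coset_def central_coset_def 
  using unif by (intro exI[of _ "\<lambda>i. \<pi> powi (- \<lfloor>\<omega> i \<mu>\<rfloor>)"] conjI refl) simp

text \<open>On the first \<open>l\<close> coordinates the bound may be rounded down because valuations are integral; on
  the others it is already an integer, and prescribing a finite valuation means prescribing a coset
  of the units.\<close>

lemma adj_le_eq_box:
  assumes \<mu>: "\<mu> \<in> newton_points L cor l \<alpha>"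
  shows "adj_le \<O> \<pi> L \<Phi> cor l \<alpha> n \<omega> \<mu> =
    adj_box \<O> \<pi> L \<Phi> cor l n \<omega> (\<lambda>i. - \<lfloor>\<omega> i \<mu>\<rfloor>) (central_coset \<mu>)"
proof -
  have "c \<in> adj_le \<O> \<pi> L \<Phi> cor l \<alpha> n \<omega> \<mu> \<longleftrightarrow>
      c \<in> adj_box \<O> \<pi> L \<Phi> cor l n \<omega> (\<lambda>i. - \<lfloor>\<omega> i \<mu>\<rfloor>) (central_coset \<mu>)"
    if c: "c \<in> adj_points \<O> L \<Phi> cor" for c
  proof -
    let ?x = "adj_coord \<Phi> cor \<omega> c"
    have 1: "val \<O> \<pi> (?x i) \<le> ereal (\<omega> i \<mu>) \<longleftrightarrow> ?x i \<in> frac_ideal \<O> \<pi> (- \<lfloor>\<omega> i \<mu>\<rfloor>)" for i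
      unfolding frac_ideal_iff_val by (subst val_le_floor) simp
    have 2: "val \<O> \<pi> (?x i) = ereal (\<omega> i \<mu>) \<longleftrightarrow>
        ?x i \<in> {u * \<pi> powi (- \<lfloor>\<omega> i \<mu>\<rfloor>) |u. u \<in> units_on \<O>}" if "i \<in> {l+1..n}" for i
    proof -
      have "\<omega> i \<mu> \<in> \<int>"
        using \<mu> central_weight[OF that] by (rule newton_point_central_integral)
      then have "\<omega> i \<mu> = real_of_int \<lfloor>\<omega> i \<mu>\<rfloor>"
        by (metis Ints_cases floor_of_int)
      then have "val \<O> \<pi> (?x i) = ereal (\<omega> i \<mu>) \<longleftrightarrow> val \<O> \<pi> (?x i) = ereal (real_of_int \<lfloor>\<omega> i \<mu>\<rfloor>)"
        by simp
      then show ?thesis unfolding val_eq_iff by blast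
    qed
    have "restrict ?x {l+1..n} \<in> central_coset \<mu> \<longleftrightarrow>
        (\<forall>i\<in>{l+1..n}. ?x i \<in> {u * \<pi> powi (- \<lfloor>\<omega> i \<mu>\<rfloor>) |u. u \<in> units_on \<O>})"
      unfolding central_coset_def by (rule restrict_PiE_iff)
    then show ?thesis
      unfolding mem_adj_le_iff[OF c newton_point_dom[OF \<mu>]] adj_box_def using c 1 2 by simp
  qed
  then show ?thesis
    by (auto simp: adj_le_def adj_box_def)
qed

end

theorem mainTheorem3:
  fixes \<O> :: "'f::field set" and \<pi> :: 'f
    and L :: "'a::{real_inner,heine_borel} set"
    and \<Phi> :: "'a dual set" and cor :: "'a dual \<Rightarrow> 'a"
    and l n :: nat and \<alpha> \<omega> :: "nat \<Rightarrow> 'a dual"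
    and \<mu> \<nu> :: 'a
  assumes "dvr \<O> \<pi>" and "fraction_field_of \<O>" and "adically_complete \<O> \<pi>"
    and "algebraically_closed (residue_ring_on \<O> \<pi>)"
    and "root_datum L \<Phi> cor" and "simply_connected_derived L \<Phi> cor"
    and "weyl_invariant_inner \<Phi> cor"
    and "simple_roots \<Phi> l \<alpha>"
    and "n = dim (UNIV :: 'a set)"
    and "extend_fundamental_weights L cor l \<alpha> \<omega>"
    and "basis_central_chars L cor l \<alpha> n \<omega>"
    and "\<mu> \<in> newton_points L cor l \<alpha>" and "\<nu> \<in> newton_points L cor l \<alpha>"
    and "coroot_le cor l \<alpha> \<nu> \<mu>"
  shows "adj_le \<O> \<pi> L \<Phi> cor l \<alpha> n \<omega> \<nu> \<subseteq> adj_le \<O> \<pi> L \<Phi> cor l \<alpha> n \<omega> \<mu>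
    \<and> has_k_codim \<O> \<pi> L \<Phi> cor l n \<omega>
        (adj_le \<O> \<pi> L \<Phi> cor l \<alpha> n \<omega> \<nu>) (adj_le \<O> \<pi> L \<Phi> cor l \<alpha> n \<omega> \<mu>)
        ((\<Sum>i=1..l. \<lfloor>blinfun_apply (\<omega> i) \<mu>\<rfloor>) - (\<Sum>i=1..l. \<lfloor>blinfun_apply (\<omega> i) \<nu>\<rfloor>))
    \<and> 0 \<le> (\<Sum>i=1..l. \<lfloor>blinfun_apply (\<omega> i) \<mu>\<rfloor>) - (\<Sum>i=1..l. \<lfloor>blinfun_apply (\<omega> i) \<nu>\<rfloor>)
    \<and> (\<forall>\<omega>'. extend_fundamental_weights L cor l \<alpha> \<omega>' \<longrightarrow>
          (\<Sum>i=1..l. \<lfloor>blinfun_apply (\<omega>' i) \<mu>\<rfloor>) - (\<Sum>i=1..l. \<lfloor>blinfun_apply (\<omega>' i) \<nu>\<rfloor>)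
          = (\<Sum>i=1..l. \<lfloor>blinfun_apply (\<omega> i) \<mu>\<rfloor>) - (\<Sum>i=1..l. \<lfloor>blinfun_apply (\<omega> i) \<nu>\<rfloor>))"
proof -
  interpret root_datum L \<Phi> cor by fact
  interpret adjoint_quotient \<O> \<pi> L \<Phi> cor l n \<alpha> \<omega>
    by unfold_locales fact+
  obtain e where "chamber l n \<alpha> \<omega> cor e"
    using exists_chamber by blast
  then interpret chamber l n \<alpha> \<omega> cor e .
  let ?S = "adj_le \<O> \<pi> L \<Phi> cor l \<alpha> n \<omega>"
  have le: "\<omega> i \<nu> \<le> \<omega> i \<mu>" if "i \<in> {1..l}" for i
    using assms(14) that by (auto simp: le_iff_weights)
  have central: "\<omega> i \<nu> = \<omega> i \<mu>" if "i \<in> {l+1..n}" for i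
    using assms(14) that by (auto simp: le_iff_weights)
  have subset: "?S \<nu> \<subseteq> ?S \<mu>"
  proof
    fix c assume c: "c \<in> ?S \<nu>"
    then show "c \<in> ?S \<mu>"
      using assms(14) by (force simp: adj_le_def le_iff_weights intro: order_trans)
  qed
  have "central_coset \<nu> = central_coset \<mu>"
    unfolding central_coset_def using central by (intro PiE_cong) simp
  then have "has_k_dim \<O> \<pi> L \<Phi> cor l n \<omega> (central_coset \<mu>) (?S \<nu>) (\<Sum>i=1..l. \<lfloor>\<omega> i \<nu>\<rfloor>)"
    "has_k_dim \<O> \<pi> L \<Phi> cor l n \<omega> (central_coset \<mu>) (?S \<mu>) (\<Sum>i=1..l. \<lfloor>\<omega> i \<mu>\<rfloor>)"
    unfolding has_k_dim_def using unit_coset_central_coset adj_le_eq_box assms(12,13)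
    by (auto simp: sum_negf intro!: exI[of _ "\<lambda>i. - \<lfloor>\<omega> i _\<rfloor>"])
  then have codim: "has_k_codim \<O> \<pi> L \<Phi> cor l n \<omega> (?S \<nu>) (?S \<mu>)
      ((\<Sum>i=1..l. \<lfloor>\<omega> i \<mu>\<rfloor>) - (\<Sum>i=1..l. \<lfloor>\<omega> i \<nu>\<rfloor>))"
    unfolding has_k_codim_def using subset by blast
  have nonneg: "(\<Sum>i=1..l. \<lfloor>\<omega> i \<nu>\<rfloor>) \<le> (\<Sum>i=1..l. \<lfloor>\<omega> i \<mu>\<rfloor>)"
    by (intro sum_mono floor_mono le)
  have indep: "(\<Sum>i=1..l. \<lfloor>\<omega>' i \<mu>\<rfloor>) - (\<Sum>i=1..l. \<lfloor>\<omega>' i \<nu>\<rfloor>)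
      = (\<Sum>i=1..l. \<lfloor>\<omega> i \<mu>\<rfloor>) - (\<Sum>i=1..l. \<lfloor>\<omega> i \<nu>\<rfloor>)"
    if \<omega>': "extend_fundamental_weights L cor l \<alpha> \<omega>'" for \<omega>'
  proof -
    have "\<lfloor>\<omega>' i \<mu>\<rfloor> - \<lfloor>\<omega>' i \<nu>\<rfloor> = \<lfloor>\<omega> i \<mu>\<rfloor> - \<lfloor>\<omega> i \<nu>\<rfloor>" if i: "i \<in> {1..l}" for i
    proof -
      define \<xi> where "\<xi> = \<omega>' i - \<omega> i"
      have \<xi>: "\<xi> \<in> central_chars L cor l \<alpha>"
        using \<omega>' weights i
        by (auto simp: \<xi>_def central_chars_def char_lattice_def extend_fundamental_weights_def
            blinfun.diff_left)
      obtain k where k: "\<xi> \<mu> = real_of_int k"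
        using newton_point_central_integral[OF assms(12) \<xi>] by (auto elim: Ints_cases)
      \<comment> \<open>As \<open>\<xi>\<close> vanishes on coroots, it also takes the value \<open>k\<close> on \<open>\<nu>\<close>.\<close>
      have "\<mu> - \<nu> \<in> span (a ` {1..l})"
      proof -
        obtain t where t: "\<mu> - \<nu> = (\<Sum>i=1..l. t i *\<^sub>R a i)"
          using assms(14) by (auto simp: coroot_le_def)
        show ?thesis unfolding t by (intro span_sum span_scale span_base) auto
      qed
      then have "\<xi> (\<mu> - \<nu>) = 0" by (rule central_vanishes_on_span[OF \<xi>])
      then have "\<xi> \<nu> = real_of_int k" using k by (simp add: blinfun.diff_right)
      with k have "\<omega>' i \<mu> = \<omega> i \<mu> + real_of_int k" "\<omega>' i \<nu> = \<omega> i \<nu> + real_of_int k"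
        by (simp_all add: \<xi>_def blinfun.diff_left)
      then show ?thesis by simp
    qed
    then show ?thesis unfolding sum_subtractf[symmetric] by (intro sum.cong) auto
  qed
  from subset codim nonneg indep show ?thesis by simp
qed

end
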